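(* Let $\Omega\subset\mathbb{C}^d\cong\mathbb{R}^{2d}$ be a Reinhardt domain with Reinhardt shadow $W\subset V^d$, and assume that $\Omega$ is thin at infinity. Let $k\in\mathbb{N}_0^d$. Then the eigenfunctions of the localization operator $A_\Omega^{\phi_k}$ are the product Hermite functions $\{\phi_n\}_{n\in\mathbb{N}_0^d}$, and the $n$-th eigenvalue is $$c_{n,k}(\Omega)=(2\pi)^d\frac{k!}{n!}\pi^{|n-k|}\int_Wr^{2n-2k+1}e^{-\pi|r|^2}\Bigl(\prod_{j=1}^dL_{k_j}^{n_j-k_j}(\pi r_j^2)\Bigr)^2\,dr .$$
   Context: Identify $\mathbb{R}^{2d}$ with $\mathbb{C}^d$ via $(x,\omega)\mapsto z=(x_1+i\omega_1,\dots,x_d+i\omega_d)$. Let $V^d=[0,\infty)^d$ and $\tau(z_1,\dots,z_d)=(|z_1|,\dots,|z_d|)$. An open set $\Omega\subset\mathbb{C}^d$ is a Reinhardt domain if $\tau^{-1}(\{\tau(z)\})\subset\Omega$ for all $z\in\Omega$; equivalently $\Omega=\tau^{-1}(W)$ for an open $W\subset V^d$, and $W$ is called the Reinhardt shadow of $\Omega$. A set $\Omega$ is thin at infinity if for one (equivalently any) $R>0$, $\lim_{|z|\to\infty}|\Omega\cap B(z,R)|=0$, with $|\cdot|$ Lebesgue measure. For $z=(x,\omega)$, $\pi(z)g(t)=e^{2\pi i\langle t,\omega\rangle}g(t-x)$ and $V_gf(z)=\langle f,\pi(z)g\rangle$. The localization operator is the weak integral $A_\Omega^gf=\int_\Omega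 V_gf(z)\pi(z)g\,dz$ on $L^2(\mathbb{R}^d)$. Hermite functions: $\phi_n(t)=\frac{2^{1/4}}{\sqrt{n!}}\bigl(\frac{-1}{2\sqrt{\pi}}\bigr)^ne^{\pi t^2}\frac{d^n}{dt^n}(e^{-2\pi t^2})$ for $n\in\mathbb{N}_0$, and $\phi_n(t_1,\dots,t_d)=\prod_j\phi_{n_j}(t_j)$ for $n\in\mathbb{N}_0^d$; they form an orthonormal basis of $L^2(\mathbb{R}^d)$. The statement that they are the eigenfunctions with $n$-th eigenvalue $c_{n,k}(\Omega)$ means $A_\Omega^{\phi_k}\phi_n=c_{n,k}(\Omega)\phi_n$ for all $n$. Multi-index notation: $k!=\prod_jk_j!$, $|n-k|=\sum_j(n_j-k_j)$ (possibly negative), $r^{2n-2k+1}=\prod_jr_j^{2n_j-2k_j+1}$, $|r|^2=\sum_jr_j^2$. Laguerre polynomials: $L_k^\alpha(t)=\sum_{j=0}^k(-1)^j\binom{k+\alpha}{k-j}\frac{t^j}{j!}$; if $n_j<k_j$, $L_{k_j}^{n_j-k_j}$ is interpreted through the reflection identity $\frac{(-t)^n}{n!}L_j^{n-j}(t)=\frac{(-t)^j}{j!}L_n^{j-n}(t)$. *)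

theory Defs
  imports "HOL-Analysis.Analysis"
begin

section \<open>Reinhardt domains\<close>

text \<open>Phase space is \<open>complex^'d\<close>, whose Euclidean norm and Lebesgue measure are those of
  $\mathbb{R}^{2d}$; the point $(x,\omega)$ is the vector with components $x_j + i\omega_j$.\<close>

definition nonneg_orthant :: "(real^'d) set" where
  "nonneg_orthant = {r. \<forall>j. 0 \<le> r $ j}"

definition modulus_map :: "complex^'d \<Rightarrow> real^'d" where
  "modulus_map z = (\<chi> j. cmod (z $ j))"

text \<open>No connectedness is required.\<close>

definition reinhardt_domain :: "(complex^'d) set \<Rightarrow> bool" where
  "reinhardt_domain \<Omega> \<longleftrightarrow> open \<Omega> \<and> (\<forall>z\<in>\<Omega>. modulus_map -` {modulus_map z} \<subseteq> \<Omega>)"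

definition reinhardt_shadow :: "(complex^'d) set \<Rightarrow> (real^'d) set \<Rightarrow> bool" where
  "reinhardt_shadow \<Omega> W \<longleftrightarrow>
     openin (top_of_set nonneg_orthant) W \<and> \<Omega> = modulus_map -` W"

text \<open>The radius is irrelevant: one $R > 0$ works iff all do.\<close>

definition thin_at_infinity :: "(complex^'d) set \<Rightarrow> bool" where
  "thin_at_infinity \<Omega> \<longleftrightarrow>
     (\<exists>R>0. ((\<lambda>z. measure lebesgue (\<Omega> \<inter> ball z R)) \<longlongrightarrow> 0) at_infinity)"

section \<open>Localization operators on $L^2(\mathbb{R}^d)$\<close>

text \<open>Elements of $L^2$ are represented by functions, so equality of elements is equality almost
  everywhere.\<close>

definition L2 :: "(real^'d \<Rightarrow> complex) set" where
  "L2 = {f. f \<in> borel_measurable lebesgue \<and> integrable lebesgue (\<lambda>t. (cmod (f t))\<^sup>2)}"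

definition L2_inner :: "(real^'d \<Rightarrow> complex) \<Rightarrow> (real^'d \<Rightarrow> complex) \<Rightarrow> complex" where
  "L2_inner f h = (LINT t|lebesgue. f t * cnj (h t))"

definition tf_shift :: "complex^'d \<Rightarrow> (real^'d \<Rightarrow> complex) \<Rightarrow> real^'d \<Rightarrow> complex" where
  "tf_shift z g t =
     exp (2 * complex_of_real pi * \<i> * complex_of_real (t \<bullet> (\<chi> j. Im (z $ j)))) *
       g (t - (\<chi> j. Re (z $ j)))"

definition stft :: "(real^'d \<Rightarrow> complex) \<Rightarrow> (real^'d \<Rightarrow> complex) \<Rightarrow> complex^'d \<Rightarrow> complex" where
  "stft g f z = L2_inner f (tf_shift z g)"

text \<open>\<open>h\<close> is the weak integral of the \<open>L2\<close>-valued map \<open>F\<close> over \<open>\<Omega>\<close>. Since \<open>u\<close> ranges over all of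
  \<open>L2\<close>, this determines \<open>h\<close> up to a null set.\<close>

definition has_weak_L2_integral ::
  "(complex^'d \<Rightarrow> real^'d \<Rightarrow> complex) \<Rightarrow> (real^'d \<Rightarrow> complex) \<Rightarrow> (complex^'d) set \<Rightarrow> bool" where
  "has_weak_L2_integral F h \<Omega> \<longleftrightarrow> h \<in> L2 \<and>
     (\<forall>u\<in>L2. set_integrable lebesgue \<Omega> (\<lambda>z. L2_inner (F z) u) \<and>
       L2_inner h u = (LINT z:\<Omega>|lebesgue. L2_inner (F z) u))"

text \<open>The graph of the localization operator with symbol $1_\Omega$ and window \<open>g\<close>:
  \<open>localization_op \<Omega> g f h\<close> says that the operator is defined at \<open>f\<close> and maps it to \<open>h\<close>.\<close>

definition localization_op ::
  "(complex^'d) set \<Rightarrow> (real^'d \<Rightarrow> complex) \<Rightarrow> (real^'d \<Rightarrow> complex) \<Rightarrow> (real^'d \<Rightarrow> complex) \<Rightarrow> bool" where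
  "localization_op \<Omega> g f h \<longleftrightarrow>
     f \<in> L2 \<and> has_weak_L2_integral (\<lambda>z t. stft g f z * tf_shift z g t) h \<Omega>"

section \<open>Hermite functions and Laguerre polynomials\<close>

definition hermite1 :: "nat \<Rightarrow> real \<Rightarrow> real" where
  "hermite1 n t = 2 powr (1/4) / sqrt (fact n) * (- 1 / (2 * sqrt pi)) ^ n * exp (pi * t\<^sup>2) *
     (deriv ^^ n) (\<lambda>s. exp (- 2 * pi * s\<^sup>2)) t"

definition hermite :: "nat^'d \<Rightarrow> real^'d \<Rightarrow> complex" where
  "hermite n t = complex_of_real (\<Prod>j\<in>UNIV. hermite1 (n $ j) (t $ j))"

definition laguerre :: "nat \<Rightarrow> real \<Rightarrow> real \<Rightarrow> real" where
  "laguerre k \<alpha> t =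
     (\<Sum>j\<le>k. (- 1) ^ j * ((real k + \<alpha>) gchoose (k - j)) * (t ^ j / fact j))"

text \<open>\<open>laguerre_diff k n\<close> is $L_k^{n-k}$. For $n < k$ it is given by the reflection identity
  $\frac{(-t)^n}{n!} L_k^{n-k}(t) = \frac{(-t)^k}{k!} L_n^{k-n}(t)$, with the factor $(-t)^n$
  cancelled.\<close>

definition laguerre_diff :: "nat \<Rightarrow> nat \<Rightarrow> real \<Rightarrow> real" where
  "laguerre_diff k n t =
     (if k \<le> n then laguerre k (real n - real k) t
      else fact n / fact k * (- t) ^ (k - n) * laguerre n (real k - real n) t)"

definition multi_fact :: "nat^'d \<Rightarrow> real" where
  "multi_fact n = (\<Prod>j\<in>UNIV. fact (n $ j))"

end

theory Submission
  imports Defs "HOL-Complex_Analysis.Complex_Singularities" "HOL-Probability.Characteristic_Functions"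
begin

text \<open>
  The eigenvalue equation already holds pointwise, before it is tested against an \<open>L2\<close> function:
  for every \<open>t\<close> the integral of \<open>stft (hermite k) (hermite n) z * tf_shift z (hermite k) t\<close> over
  \<open>\<Omega>\<close> is a constant multiple of \<open>hermite n t\<close>. The weak form follows by Fubini, because the
  transform of one Hermite function against another is integrable over all of phase space
  (\<open>localization_kernel_integrable\<close>).

  The pointwise identity rests on the torus symmetry. The map \<open>z \<mapsto> (u\<^sub>j z\<^sub>j)\<close> with unimodular
  \<open>u\<^sub>j\<close> preserves \<open>\<Omega>\<close> and Lebesgue measure, so the integrand may be replaced by its mean over the
  torus (\<open>torus_average\<close>). Integrand and mean factorise over the coordinates, which leaves a
  one-dimensional statement: the mean over a circle of
  \<open>cnj (overlap1 n k z) * shift1 z (hermite1 k) t\<close> is \<open>eigendensity n k z * hermite1 n t\<close>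
  (\<open>circle_mean_overlap1\<close>).

  In one dimension everything is read off from the generating function \<open>coherent w t\<close>, an entire
  function of \<open>w\<close> whose Taylor coefficients at \<open>0\<close> are multiples of the Hermite functions. A
  time-frequency shift by \<open>z\<close> turns \<open>coherent w\<close> into a scalar times \<open>coherent (z + w)\<close>
  (\<open>shift1_coherent\<close>), so Leibniz' rule writes the shifted Hermite function of degree \<open>k\<close> as a sum
  of terms \<open>(cnj z) ^ i * D (k - i) z\<close> with \<open>D j\<close> the entire \<open>j\<close>-th derivative of
  \<open>w \<mapsto> coherent w t\<close>. The overlap with the Hermite function of degree \<open>n\<close> is homogeneous under
  rotation of \<open>z\<close>, and by Cauchy's formula the mean over a circle against this character selects
  one Taylor coefficient of each \<open>D (k - i)\<close>. That coefficient is a scalar multiple of the \<open>n\<close>-th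
  derivative of \<open>w \<mapsto> coherent w t\<close> at \<open>0\<close>, hence of \<open>hermite1 n t\<close>, and the scalars add up to a
  Laguerre polynomial in \<open>pi * (norm z)\<^sup>2\<close> (\<open>overlap_poly_laguerre\<close>).
  The eigenvalue is then an integral over \<open>\<Omega>\<close> of a function of the moduli, and pushing Lebesgue
  measure forward along \<open>modulus_map\<close> gives the integral over \<open>W\<close> with density \<open>2 * pi * r\<^sub>j\<close> in
  each coordinate (\<open>integral_reinhardt\<close>).
\<close>

section \<open>Lebesgue measure on vectors, rotations and moduli\<close>

lemma measurable_vec_lambda [measurable]:
  assumes "\<And>j. f j \<in> borel_measurable M"
  shows "(\<lambda>x. \<chi> j::'d. f j x) \<in> M \<rightarrow>\<^sub>M (borel :: ('a::euclidean_space^'d) measure)"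
  unfolding borel_measurable_euclidean_space[where f = "\<lambda>x. \<chi> j. f j x"]
  using assms by (auto simp: Basis_vec_def inner_axis)

lemma measurable_vec_nth [measurable]:
  "(\<lambda>x :: 'a::euclidean_space^'d. x $ j) \<in> borel_measurable borel"
  by (intro borel_measurable_continuous_onI continuous_intros)

lemma cnj_measurable [measurable]: "cnj \<in> borel_measurable borel"
  by (intro borel_measurable_continuous_onI continuous_intros)

lemma product_sigma_finite_lborel: "product_sigma_finite (\<lambda>_. lborel)"
  by (intro product_sigma_finite.intro) (rule sigma_finite_lborel)

lemma prod_Basis_vec:
  fixes f :: "'a::euclidean_space^'d \<Rightarrow> 'b::comm_monoid_mult"
  shows "(\<Prod>b\<in>Basis. f b) = (\<Prod>j\<in>UNIV. \<Prod>b\<in>Basis. f (axis j b))"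
proof -
  have Basis: "(Basis :: ('a^'d) set) = (\<lambda>(j, b). axis j b) ` (UNIV \<times> Basis)"
    by (auto simp: Basis_vec_def)
  have "inj_on (\<lambda>(j, b). axis j b :: 'a^'d) (UNIV \<times> Basis)"
    by (auto simp: inj_on_def axis_eq_axis)
  then show ?thesis
    by (subst Basis) (simp add: prod.reindex prod.cartesian_product case_prod_beta')
qed

text \<open>Lebesgue measure on vectors is written as an image of a product measure because the theory of
  \<open>PiM\<close> then gives Fubini and image measures one coordinate at a time.\<close>

lemma lborel_vec:
  "(lborel :: ('a::euclidean_space^'d) measure)
    = distr (PiM UNIV (\<lambda>_. lborel)) borel (\<lambda>f. \<chi> j. f j)"
proof (rule lborel_eqI)
  interpret product_sigma_finite "\<lambda>_::'d. lborel :: 'a measure"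
    by (rule product_sigma_finite_lborel)
  fix l u :: "'a^'d" assume lu: "\<And>b. b \<in> Basis \<Longrightarrow> l \<bullet> b \<le> u \<bullet> b"
  have le: "l $ j \<bullet> b \<le> u $ j \<bullet> b" if "b \<in> Basis" for j b
    using lu[of "axis j b"] that by (auto simp: inner_axis Basis_vec_def)
  have "(\<lambda>f. \<chi> j. f j) -` box l u \<inter> space (PiM UNIV (\<lambda>_. lborel)) = (\<Pi>\<^sub>E j\<in>UNIV. box (l $ j) (u $ j))"
    by (auto simp: space_PiM mem_box Basis_vec_def inner_axis PiE_iff)
  then have "emeasure (distr (PiM UNIV (\<lambda>_. lborel)) borel (\<lambda>f. \<chi> j. f j)) (box l u)
      = (\<Prod>j\<in>UNIV. emeasure lborel (box (l $ j) (u $ j)))"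
    by (simp add: emeasure_distr emeasure_PiM)
  also have "\<dots> = (\<Prod>b\<in>Basis. (u - l) \<bullet> b)"
    using le by (simp add: emeasure_lborel_box_eq prod_Basis_vec inner_axis prod_nonneg
        inner_diff_left prod_ennreal)
  finally show "emeasure (distr (PiM UNIV (\<lambda>_. lborel)) borel (\<lambda>f. \<chi> j. f j)) (box l u)
      = (\<Prod>b\<in>Basis. (u - l) \<bullet> b)" .
qed simp

lemma distr_PiM_componentwise:
  fixes M :: "'i \<Rightarrow> 'a measure" and N :: "'i \<Rightarrow> 'b measure"
  assumes I: "finite I" and M: "product_sigma_finite M" and N: "product_sigma_finite N"
    and T [measurable]: "\<And>j. j \<in> I \<Longrightarrow> T j \<in> M j \<rightarrow>\<^sub>M N j"
    and TM: "\<And>j. j \<in> I \<Longrightarrow> distr (M j) (N j) (T j) = N j"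
  shows "distr (PiM I M) (PiM I N) (\<lambda>f. \<lambda>j\<in>I. T j (f j)) = PiM I N"
proof (rule product_sigma_finite.PiM_eqI[OF N I])
  interpret M: product_sigma_finite M by fact
  fix A assume A: "\<And>j. j \<in> I \<Longrightarrow> A j \<in> sets (N j)"
  have [measurable]: "(\<lambda>f. \<lambda>j\<in>I. T j (f j)) \<in> PiM I M \<rightarrow>\<^sub>M PiM I N"
    by (rule measurable_restrict) (use T in measurable)
  have [measurable]: "Pi\<^sub>E I A \<in> sets (PiM I N)"
    using A I by (intro sets_PiM_I_finite) auto
  have "(\<lambda>f. \<lambda>j\<in>I. T j (f j)) -` Pi\<^sub>E I A \<inter> space (PiM I M) = (\<Pi>\<^sub>E j\<in>I. T j -` A j \<inter> space (M j))"
    by (auto simp: space_PiM PiE_iff)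
  then have "emeasure (distr (PiM I M) (PiM I N) (\<lambda>f. \<lambda>j\<in>I. T j (f j))) (Pi\<^sub>E I A)
      = emeasure (PiM I M) (\<Pi>\<^sub>E j\<in>I. T j -` A j \<inter> space (M j))"
    by (simp add: emeasure_distr)
  also have "\<dots> = (\<Prod>j\<in>I. emeasure (M j) (T j -` A j \<inter> space (M j)))"
    using A I T by (intro M.emeasure_PiM) auto
  also have "\<dots> = (\<Prod>j\<in>I. emeasure (N j) (A j))"
  proof (rule prod.cong)
    fix j assume j: "j \<in> I"
    have "emeasure (N j) (A j) = emeasure (distr (M j) (N j) (T j)) (A j)"
      using TM[OF j] by simp
    then show "emeasure (M j) (T j -` A j \<inter> space (M j)) = emeasure (N j) (A j)"
      using A j T by (simp add: emeasure_distr)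
  qed simp
  finally show "emeasure (distr (PiM I M) (PiM I N) (\<lambda>f. \<lambda>j\<in>I. T j (f j))) (Pi\<^sub>E I A)
      = (\<Prod>j\<in>I. emeasure (N j) (A j))" .
qed simp

text \<open>Serves both for rotations of the coordinates and for passing to their moduli.\<close>

lemma distr_lborel_componentwise:
  fixes T :: "'d::finite \<Rightarrow> 'a::euclidean_space \<Rightarrow> 'b::euclidean_space"
  assumes N: "product_sigma_finite N" and sets: "\<And>j. sets (N j) = sets borel"
    and T [measurable]: "\<And>j. T j \<in> borel_measurable borel"
    and TN: "\<And>j. distr lborel borel (T j) = N j"
  shows "distr lborel borel (\<lambda>z::'a^'d. \<chi> j. T j (z $ j)) = distr (PiM UNIV N) borel (\<lambda>f. \<chi> j. f j)"
proof -
  note [measurable_cong] = sets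
  have TN': "distr lborel (N j) (T j) = N j" for j
    using TN[of j] by (simp cong: distr_cong add: sets)
  have T': "T j \<in> lborel \<rightarrow>\<^sub>M N j" for j
    by measurable
  have 1: "distr (PiM UNIV (\<lambda>_. lborel)) (PiM UNIV N) (\<lambda>f. \<lambda>j\<in>UNIV. T j (f j)) = PiM UNIV N"
    by (rule distr_PiM_componentwise) (use N TN' product_sigma_finite_lborel in \<open>auto intro: T'\<close>)
  have [measurable]: "(\<lambda>f. \<lambda>j\<in>UNIV. T j (f j)) \<in> PiM UNIV (\<lambda>_. lborel) \<rightarrow>\<^sub>M PiM UNIV N"
    by (rule measurable_restrict) measurable
  have [measurable]: "(\<lambda>f. \<chi> j::'d. f j) \<in> PiM UNIV N \<rightarrow>\<^sub>M (borel :: ('b^'d) measure)"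
    by measurable
  have "distr lborel borel (\<lambda>z::'a^'d. \<chi> j. T j (z $ j))
      = distr (PiM UNIV (\<lambda>_. lborel)) borel (\<lambda>f. \<chi> j. T j (f j))"
    by (subst lborel_vec, subst distr_distr) (auto simp: o_def)
  also have "\<dots> = distr (distr (PiM UNIV (\<lambda>_. lborel)) (PiM UNIV N) (\<lambda>f. \<lambda>j\<in>UNIV. T j (f j))) borel (\<lambda>f. \<chi> j. f j)"
    by (subst distr_distr) (measurable, simp add: o_def restrict_UNIV)
  also have "\<dots> = distr (PiM UNIV N) borel (\<lambda>f. \<chi> j. f j)"
    by (simp only: 1)
  finally show ?thesis .
qed

lemma distr_lborel_complex_vec:
  "distr lborel borel (\<lambda>z. vector [Re z, Im z]) = (lborel :: (real^2) measure)"
proof (rule lborel_eqI[symmetric])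
  have meas: "(\<lambda>z. vector [Re z, Im z] :: real^2) \<in> borel_measurable borel"
    by (rule borel_measurable_euclidean_space[THEN iffD2])
       (auto simp: Basis_vec_def inner_axis exhaust_2 UNIV_2)
  fix l u :: "real^2" assume lu: "\<And>b. b \<in> Basis \<Longrightarrow> l \<bullet> b \<le> u \<bullet> b"
  have "(\<lambda>z. vector [Re z, Im z]) -` box l u = box (Complex (l$1) (l$2)) (Complex (u$1) (u$2))"
    by (auto simp: mem_box_cart in_box_complex_iff forall_2)
  moreover have "l$1 \<le> u$1" "l$2 \<le> u$2"
    using lu[of "axis 1 1"] lu[of "axis 2 1"] by (auto simp: inner_axis)
  ultimately show "emeasure (distr lborel borel (\<lambda>z. vector [Re z, Im z])) (box l u) = (\<Prod>b\<in>Basis. (u - l) \<bullet> b)"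
    using meas by (simp add: emeasure_distr emeasure_lborel_box_eq Basis_complex_def
        prod_Basis_vec UNIV_2 inner_axis inner_complex_def ennreal_mult')
qed simp

text \<open>A rotation is an orthogonal map of \<open>real^2\<close>, which preserves measure; the coordinate isometry
  carries this over to the complex plane.\<close>

lemma lborel_distr_cmod_1_mult:
  fixes u :: complex
  assumes u: "cmod u = 1"
  shows "distr lborel borel ((*) u) = lborel"
proof -
  \<comment> \<open>\<open>V\<close> and \<open>C\<close> are the mutually inverse coordinate isometries; \<open>R\<close> is the rotation by \<open>u\<close> in
    these coordinates, and \<open>R'\<close> its inverse.\<close>
  define V :: "complex \<Rightarrow> real^2" where "V = (\<lambda>z. vector [Re z, Im z])"
  define C :: "real^2 \<Rightarrow> complex" where "C = (\<lambda>x. Complex (x $ 1) (x $ 2))"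
  define R where "R = V \<circ> (*) u \<circ> C"
  define R' where "R' = V \<circ> (*) (cnj u) \<circ> C"
  have CV [simp]: "C (V z) = z" for z by (simp add: C_def V_def)
  have VC [simp]: "V (C x) = x" for x by (simp add: C_def V_def vec_eq_iff forall_2)
  have uu: "cnj u * u = 1" "u * cnj u = 1"
    using u by (simp_all add: complex_norm_square [symmetric] mult.commute)
  have linC: "linear C" by (rule linearI) (auto simp: C_def complex_eq_iff)
  have linV: "linear V" by (rule linearI) (auto simp: V_def vec_eq_iff forall_2)
  have nC: "norm (C x) = norm x" for x
    by (simp add: C_def norm_vec_def L2_set_def UNIV_2 cmod_def)
  have nV: "norm (V z) = norm z" for z
    using nC[of "V z"] by simp
  have linR': "linear R'"
    unfolding R'_def by (intro linear_compose linC linV) (auto intro!: linearI simp: algebra_simps)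
  have linR: "linear R"
    unfolding R_def by (intro linear_compose linC linV) (auto intro!: linearI simp: algebra_simps)
  have orth: "orthogonal_transformation R'"
    using linR' u by (auto simp: orthogonal_transformation R'_def nC nV norm_mult)
  have [measurable]: "V \<in> borel_measurable borel" "C \<in> borel_measurable borel" "R \<in> borel_measurable borel"
    using linC linV linR
    by (auto intro!: borel_measurable_continuous_onI linear_continuous_on simp: linear_conv_bounded_linear)
  have V: "distr lborel borel V = lborel"
    unfolding V_def by (rule distr_lborel_complex_vec)
  have C: "distr lborel borel C = lborel"
    by (subst V [symmetric]) (simp add: distr_distr o_def distr_id2)
  have R: "distr lborel borel R = lborel"
  proof (rule lborel_eqI [symmetric])
    fix l u' :: "real^2" assume lu: "\<And>b. b \<in> Basis \<Longrightarrow> l \<bullet> b \<le> u' \<bullet> b"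
    have "R x \<in> B \<longleftrightarrow> x \<in> R' ` B" for x B
    proof -
      have "R' (R y) = y" "R (R' y) = y" for y
        by (simp_all add: R_def R'_def uu flip: mult.assoc)
      then show ?thesis by (metis image_iff)
    qed
    then have "R -` box l u' = R' ` box l u'" by auto
    then have "emeasure (distr lborel borel R) (box l u') = emeasure lborel (R' ` box l u')"
      by (simp add: emeasure_distr)
    also have "\<dots> = emeasure lebesgue (R' ` box l u')"
    proof -
      have "R -` box l u' \<inter> space borel \<in> sets borel"
        by (rule measurable_sets[of _ _ borel]) auto
      with \<open>R -` box l u' = R' ` box l u'\<close> show ?thesis by simp
    qed
    also have "\<dots> = emeasure lebesgue (box l u')"
      using measurable_orthogonal_image[OF orth, of "box l u'"] measure_orthogonal_image[OF orth, of "box l u'"]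
      by (simp add: emeasure_eq_measure2)
    also have "\<dots> = (\<Prod>b\<in>Basis. (u' - l) \<bullet> b)"
      using lu by (simp add: emeasure_lborel_box_eq)
    finally show "emeasure (distr lborel borel R) (box l u') = (\<Prod>b\<in>Basis. (u' - l) \<bullet> b)" .
  qed simp
  have "distr lborel borel ((*) u) = distr (distr (distr lborel borel V) borel R) borel C"
    by (simp add: distr_distr o_def R_def)
  also have "\<dots> = lborel"
    by (simp add: V R C)
  finally show ?thesis .
qed

lemma lborel_distr_torus:
  fixes u :: "'d::finite \<Rightarrow> complex"
  assumes "\<And>j. cmod (u j) = 1"
  shows "distr lborel borel (\<lambda>z::complex^'d. \<chi> j. u j * z $ j) = lborel"
  using distr_lborel_componentwise[of "\<lambda>_. lborel" "\<lambda>j. (*) (u j)"] assms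
  by (simp add: lborel_distr_cmod_1_mult product_sigma_finite_lborel flip: lborel_vec)

text \<open>Polar coordinates for radial functions. Both measures give the half-line up to \<open>a\<close> the area of
  the disc of radius \<open>a\<close>. The density vanishes on negative \<open>r\<close> since \<open>ennreal\<close> truncates.\<close>

lemma distr_lborel_cmod:
  "distr lborel borel cmod = density lborel (\<lambda>r. ennreal (2 * pi * r))"
proof (rule measure_eqI_generator_eq)
  let ?E = "range (\<lambda>a::real. {..a})"
  show "Int_stable ?E" by (auto simp: Int_stable_def)
  show "?E \<subseteq> Pow UNIV" by auto
  show "sets (distr lborel borel cmod) = sigma_sets UNIV ?E"
    "sets (density lborel (\<lambda>r. ennreal (2 * pi * r))) = sigma_sets UNIV ?E"
    by (simp_all add: borel_eq_atMost)
  let ?A = "\<lambda>n::nat. {..real n}"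
  show "range ?A \<subseteq> ?E" by auto
  show "(\<Union>n. ?A n) = UNIV" by (auto simp: real_arch_simple)
  have eq: "emeasure (distr lborel borel cmod) {..a} = ennreal (if a \<ge> 0 then pi * a\<^sup>2 else 0)" for a
  proof -
    have "cmod -` {..a} = cball 0 a" by auto
    then show ?thesis
      by (auto simp: emeasure_distr emeasure_cball unit_ball_vol_2 cball_empty)
  qed
  show "emeasure (distr lborel borel cmod) (?A i) \<noteq> \<infinity>" for i
    by (simp add: eq)
  fix X assume "X \<in> ?E"
  then obtain a where X: "X = {..a}" by auto
  have "emeasure (density lborel (\<lambda>r. ennreal (2 * pi * r))) {..a}
      = (\<integral>\<^sup>+r. ennreal (2 * pi * r) * indicator {0..a} r \<partial>lborel)"
    by (subst emeasure_density)
       (auto intro!: nn_integral_cong simp: indicator_def ennreal_neg mult_nonneg_nonpos)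
  also have "\<dots> = ennreal (if a \<ge> 0 then pi * a\<^sup>2 else 0)"
  proof (cases "a \<ge> 0")
    case True
    have "(\<integral>\<^sup>+r. ennreal (2 * pi * r) * indicator {0..a} r \<partial>lborel) = ennreal (pi * a\<^sup>2 - pi * 0\<^sup>2)"
      using True
      by (intro nn_integral_FTC_Icc[where F = "\<lambda>r. pi * r\<^sup>2" and f = "\<lambda>r. 2 * pi * r"])
         (auto simp flip: has_real_derivative_iff_has_vector_derivative intro!: derivative_eq_intros)
    then show ?thesis using True by simp
  qed auto
  finally show "emeasure (distr lborel borel cmod) X = emeasure (density lborel (\<lambda>r. ennreal (2 * pi * r))) X"
    by (simp add: X eq)
qed

lemma PiM_density_lborel:
  fixes w :: "'d::finite \<Rightarrow> real \<Rightarrow> ennreal"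
  assumes w [measurable]: "\<And>j. w j \<in> borel_measurable borel"
    and sf: "product_sigma_finite (\<lambda>j. density lborel (w j))"
  shows "PiM UNIV (\<lambda>j. density lborel (w j)) = density (PiM UNIV (\<lambda>_. lborel)) (\<lambda>f. \<Prod>j\<in>UNIV. w j (f j))"
proof (rule product_sigma_finite.PiM_eqI [OF sf, symmetric])
  interpret product_sigma_finite "\<lambda>_::'d. lborel :: real measure"
    by (rule product_sigma_finite_lborel)
  show "sets (density (PiM UNIV (\<lambda>_. lborel)) (\<lambda>f. \<Prod>j\<in>UNIV. w j (f j))) = sets (PiM UNIV (\<lambda>j. density lborel (w j)))"
    unfolding sets_density by (rule sets_PiM_cong) simp_all
  fix A assume "\<And>j. j \<in> UNIV \<Longrightarrow> A j \<in> sets (density lborel (w j))"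
  then have A [measurable]: "A j \<in> sets borel" for j by simp
  have [measurable]: "Pi\<^sub>E UNIV A \<in> sets (PiM UNIV (\<lambda>_. lborel))"
    by (intro sets_PiM_I_finite) auto
  have "emeasure (density (PiM UNIV (\<lambda>_. lborel)) (\<lambda>f. \<Prod>j\<in>UNIV. w j (f j))) (Pi\<^sub>E UNIV A)
     = (\<integral>\<^sup>+f. (\<Prod>j\<in>UNIV. w j (f j)) * indicator (Pi\<^sub>E UNIV A) f \<partial>PiM UNIV (\<lambda>_. lborel))"
    by (rule emeasure_density) measurable
  also have "\<dots> = (\<integral>\<^sup>+f. (\<Prod>j\<in>UNIV. w j (f j) * indicator (A j) (f j)) \<partial>PiM UNIV (\<lambda>_. lborel))"
  proof (rule nn_integral_cong)
    fix f
    have "indicator (Pi\<^sub>E UNIV A) f = (\<Prod>j\<in>UNIV. indicator (A j) (f j) :: ennreal)"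
      by (cases "\<forall>j. f j \<in> A j") (auto simp: indicator_def PiE_iff intro!: prod_zero)
    then show "(\<Prod>j\<in>UNIV. w j (f j)) * indicator (Pi\<^sub>E UNIV A) f = (\<Prod>j\<in>UNIV. w j (f j) * indicator (A j) (f j))"
      by (simp add: prod.distrib)
  qed
  also have "\<dots> = (\<Prod>j\<in>UNIV. \<integral>\<^sup>+x. w j x * indicator (A j) x \<partial>lborel)"
    by (subst product_nn_integral_prod) auto
  also have "\<dots> = (\<Prod>j\<in>UNIV. emeasure (density lborel (w j)) (A j))"
    by (intro prod.cong) (auto simp: emeasure_density)
  finally show "emeasure (density (PiM UNIV (\<lambda>_. lborel)) (\<lambda>f. \<Prod>j\<in>UNIV. w j (f j))) (Pi\<^sub>E UNIV A)
     = (\<Prod>j\<in>UNIV. emeasure (density lborel (w j)) (A j))" .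
qed simp

lemma modulus_map_measurable [measurable]: "modulus_map \<in> borel_measurable borel"
  unfolding modulus_map_def by measurable

text \<open>The density vanishes outside the orthant, since each factor truncates negative coordinates
  to \<open>0\<close>.\<close>

lemma distr_lborel_modulus_map:
  "distr lborel borel (modulus_map :: complex^'d \<Rightarrow> real^'d)
    = density lborel (\<lambda>r. \<Prod>j\<in>UNIV. ennreal (2 * pi * r $ j))"
proof -
  let ?w = "\<lambda>r::real. ennreal (2 * pi * r)"
  have sf: "product_sigma_finite (\<lambda>_::'d. density lborel ?w)"
    unfolding product_sigma_finite_def
    by (simp add: sigma_finite_measure.sigma_finite_iff_density_finite [OF sigma_finite_lborel])
  have "distr lborel borel (modulus_map :: complex^'d \<Rightarrow> real^'d)
      = distr (PiM UNIV (\<lambda>_. density lborel ?w)) borel (\<lambda>f. \<chi> j. f j)"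
    unfolding modulus_map_def [abs_def]
    by (rule distr_lborel_componentwise [OF sf]) (simp_all add: distr_lborel_cmod)
  also have "\<dots> = distr (density (PiM UNIV (\<lambda>_. lborel)) (\<lambda>f. \<Prod>j\<in>UNIV. ?w ((\<chi> j. f j :: real^'d) $ j))) borel (\<lambda>f. \<chi> j. f j)"
    using PiM_density_lborel[of "\<lambda>_. ?w", OF _ sf] by simp
  also have "\<dots> = density lborel (\<lambda>r. \<Prod>j\<in>UNIV. ?w (r $ j))"
    by (subst density_distr [symmetric]) (measurable, simp only: lborel_vec [symmetric])
  finally show ?thesis .
qed

section \<open>Means over circles\<close>

lemma cis_measurable [measurable]: "cis \<in> borel_measurable borel"
  by (intro borel_measurable_continuous_onI continuous_intros)

definition circle_measure :: "real measure" where
  "circle_measure = density lborel (\<lambda>\<theta>. ennreal (indicator {0..2 * pi} \<theta> / (2 * pi)))"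

lemma sets_circle_measure [simp, measurable_cong]: "sets circle_measure = sets borel"
  and space_circle_measure [simp]: "space circle_measure = UNIV"
  by (simp_all add: circle_measure_def)

lemma prob_space_circle_measure: "prob_space circle_measure"
proof
  have "emeasure circle_measure (space circle_measure)
      = (\<integral>\<^sup>+\<theta>. ennreal (1 / (2 * pi)) * indicator {0..2 * pi} \<theta> \<partial>lborel)"
    unfolding circle_measure_def
    by (subst emeasure_density) (auto intro!: nn_integral_cong simp: indicator_def)
  also have "\<dots> = 1"
    by (simp add: nn_integral_cmult ennreal_mult' [symmetric])
  finally show "emeasure circle_measure (space circle_measure) = 1" .
qed

interpretation circle: prob_space circle_measure
  by (rule prob_space_circle_measure)

lemma integrable_circle_measure:
  fixes f :: "real \<Rightarrow> complex"
  assumes f: "continuous_on UNIV f"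
  shows "integrable circle_measure f"
proof -
  have [measurable]: "f \<in> borel_measurable borel"
    by (rule borel_measurable_continuous_onI [OF f])
  have "set_integrable lborel {0..2 * pi} f"
    by (rule borel_integrable_atLeastAtMost') (use f continuous_on_subset in auto)
  then have "integrable lborel (\<lambda>\<theta>. (1 / (2 * pi)) *\<^sub>R (indicat_real {0..2 * pi} \<theta> *\<^sub>R f \<theta>))"
    unfolding set_integrable_def by (rule integrable_scaleR_right)
  then show ?thesis
    unfolding circle_measure_def by (subst integrable_density) auto
qed

lemma integral_circle_measure:
  fixes f :: "real \<Rightarrow> complex"
  assumes f: "continuous_on UNIV f" and I: "(f has_integral I) {0..2 * pi}"
  shows "integral\<^sup>L circle_measure f = I / (2 * pi)"
proof -
  have meas [measurable]: "f \<in> borel_measurable borel"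
    by (rule borel_measurable_continuous_onI [OF f])
  have int: "set_integrable lborel {0..2 * pi} f"
    by (rule borel_integrable_atLeastAtMost') (use f continuous_on_subset in auto)
  have "integral\<^sup>L circle_measure f = (\<integral>\<theta>. (indicat_real {0..2 * pi} \<theta> / (2 * pi)) *\<^sub>R f \<theta> \<partial>lborel)"
    unfolding circle_measure_def by (rule integral_density) auto
  also have "\<dots> = (\<integral>\<theta>. (1 / (2 * pi)) *\<^sub>R (indicat_real {0..2 * pi} \<theta> *\<^sub>R f \<theta>) \<partial>lborel)"
    by simp
  also have "\<dots> = (1 / (2 * pi)) *\<^sub>R (LINT \<theta>:{0..2 * pi}|lborel. f \<theta>)"
    unfolding set_lebesgue_integral_def by (rule integral_scaleR_right)
  also have "(LINT \<theta>:{0..2 * pi}|lborel. f \<theta>) = I"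
    using set_borel_integral_eq_integral(2) [OF int] I by (simp add: integral_unique)
  finally show ?thesis by (simp add: scaleR_conv_of_real)
qed

text \<open>Cauchy's formula for the derivatives at \<open>0\<close> of the dilated function \<open>w \<mapsto> f (z * w)\<close> on the unit
  circle. Dilating the function instead of the circle covers \<open>z = 0\<close>. For negative \<open>p\<close> the
  integrand is holomorphic in the disc, so the mean is \<open>0\<close>.\<close>

lemma circle_mean_holomorphic:
  fixes f :: "complex \<Rightarrow> complex" and p :: int
  assumes hol: "f holomorphic_on UNIV"
  shows "(\<integral>\<theta>. f (cis \<theta> * z) * cis (- (of_int p * \<theta>)) \<partial>circle_measure)
    = (if p \<ge> 0 then z ^ nat p * (deriv ^^ nat p) f 0 / fact (nat p) else 0)"
proof -
  define g where "g = (\<lambda>w. f (z * w))"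
  have g: "g holomorphic_on S" for S
    unfolding g_def
    by (rule holomorphic_on_compose_gen [OF _ hol, unfolded o_def]) (auto intro!: holomorphic_intros)
  have cont_f: "continuous_on UNIV f"
    using hol by (rule holomorphic_on_imp_continuous_on)
  have cont: "continuous_on UNIV (\<lambda>\<theta>. f (cis \<theta> * z) * cis (- (of_int p * \<theta>)))"
    by (intro continuous_intros continuous_on_compose2 [OF cont_f]) auto
  have circ: "circlepath 0 1 = part_circlepath 0 1 0 (2 * pi)"
    by (simp add: circlepath_def)
  show ?thesis
  proof (cases "p \<ge> 0")
    case True
    define k where "k = nat p"
    have pk: "of_int p = real k" using True by (simp add: k_def)
    have "((\<lambda>u. g u / (u - 0) ^ Suc k) has_contour_integral
        complex_of_real (2 * pi) * \<i> / fact k * (deriv ^^ k) g 0) (circlepath 0 1)"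
      using g holomorphic_on_imp_continuous_on [OF g]
      by (intro Cauchy_has_contour_integral_higher_derivative_circlepath) auto
    then have "((\<lambda>\<theta>. g (cis \<theta>) / cis \<theta> ^ Suc k * \<i> * cis \<theta>) has_integral
        complex_of_real (2 * pi) * \<i> / fact k * (deriv ^^ k) g 0) {0..2 * pi}"
      unfolding circ by (subst (asm) has_contour_integral_part_circlepath_iff) auto
    from has_integral_mult_left [OF this, of "- \<i>"]
    have "((\<lambda>\<theta>. g (cis \<theta>) / cis \<theta> ^ Suc k * \<i> * cis \<theta> * (- \<i>)) has_integral
        complex_of_real (2 * pi) / fact k * (deriv ^^ k) g 0) {0..2 * pi}"
      by (simp add: field_simps)
    moreover have "g (cis \<theta>) / cis \<theta> ^ Suc k * \<i> * cis \<theta> * (- \<i>) = f (cis \<theta> * z) * cis (- (of_int p * \<theta>))" for \<theta>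
    proof -
      have "cis (- (of_int p * \<theta>)) = inverse (cis \<theta> ^ k)"
        by (simp only: pk Complex.DeMoivre cis_inverse)
      then show ?thesis by (simp add: g_def field_simps)
    qed
    ultimately have "((\<lambda>\<theta>. f (cis \<theta> * z) * cis (- (of_int p * \<theta>))) has_integral
        complex_of_real (2 * pi) / fact k * (deriv ^^ k) g 0) {0..2 * pi}"
      by simp
    from integral_circle_measure [OF cont this]
    have "(\<integral>\<theta>. f (cis \<theta> * z) * cis (- (of_int p * \<theta>)) \<partial>circle_measure) = (deriv ^^ k) g 0 / fact k"
      by simp
    also have "(deriv ^^ k) g 0 = z ^ k * (deriv ^^ k) f 0"
      unfolding g_def using higher_deriv_compose_linear [OF hol, of UNIV 0 z k] by simp
    finally show ?thesis using True by (simp add: k_def)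
  next
    case False
    define q where "q = nat (- p) - 1"
    have pq: "of_int p = - real (Suc q)" using False by (simp add: q_def)
    have "((\<lambda>u. g u * u ^ q) has_contour_integral 0) (circlepath 0 1)"
      by (rule Cauchy_theorem_disc_simple [of _ 0 2]) (auto intro!: holomorphic_intros g simp: dist_norm)
    then have "((\<lambda>\<theta>. g (cis \<theta>) * cis \<theta> ^ q * \<i> * cis \<theta>) has_integral 0) {0..2 * pi}"
      unfolding circ by (subst (asm) has_contour_integral_part_circlepath_iff) auto
    from has_integral_mult_left [OF this, of "- \<i>"]
    have "((\<lambda>\<theta>. g (cis \<theta>) * cis \<theta> ^ q * \<i> * cis \<theta> * (- \<i>)) has_integral 0) {0..2 * pi}"
      by simp
    moreover have "g (cis \<theta>) * cis \<theta> ^ q * \<i> * cis \<theta> * (- \<i>) = f (cis \<theta> * z) * cis (- (of_int p * \<theta>))" for \<theta>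
    proof -
      have "cis \<theta> ^ q * cis \<theta> = cis (- (of_int p * \<theta>))"
        by (simp add: pq Complex.DeMoivre cis_mult algebra_simps)
      then show ?thesis by (simp add: g_def mult_ac)
    qed
    ultimately have "((\<lambda>\<theta>. f (cis \<theta> * z) * cis (- (of_int p * \<theta>))) has_integral 0) {0..2 * pi}"
      by simp
    from integral_circle_measure [OF cont this] show ?thesis using False by simp
  qed
qed

section \<open>Gaussian generating function of the Hermite functions\<close>

text \<open>Links the real derivatives in the Rodrigues formula of \<open>hermite1\<close> to derivatives of entire
  functions, where Cauchy's formula applies.\<close>

lemma higher_deriv_of_real:
  fixes f :: "complex \<Rightarrow> complex" and g :: "real \<Rightarrow> real"
  assumes hol: "f holomorphic_on UNIV" and fg: "\<And>s. f (of_real s) = of_real (g s)"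
  shows "(deriv ^^ n) f (of_real t) = of_real ((deriv ^^ n) g t)"
proof (induction n arbitrary: t)
  case 0
  then show ?case by (simp add: fg)
next
  case (Suc n)
  let ?F = "(deriv ^^ n) f" and ?G = "(deriv ^^ n) g"
  have "(?F has_field_derivative deriv ?F (of_real t)) (at (of_real t))"
    by (rule holomorphic_derivI [OF holomorphic_higher_deriv [OF hol open_UNIV] open_UNIV UNIV_I])
  then have "((\<lambda>s. ?F (of_real s)) has_vector_derivative deriv ?F (of_real t)) (at t)"
    by (rule has_vector_derivative_real_field)
  then have d: "((\<lambda>s. complex_of_real (?G s)) has_vector_derivative deriv ?F (of_real t)) (at t)"
    by (simp add: Suc.IH)
  have "(?G has_real_derivative Re (deriv ?F (of_real t))) (at t)"
    using bounded_linear.has_vector_derivative [OF bounded_linear_Re d] by (simp add: has_real_derivative_iff_has_vector_derivative)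
  moreover have "((\<lambda>s. 0 :: real) has_real_derivative Im (deriv ?F (of_real t))) (at t)"
    using bounded_linear.has_vector_derivative [OF bounded_linear_Im d] by (simp add: has_real_derivative_iff_has_vector_derivative)
  then have "Im (deriv ?F (of_real t)) = 0"
    by (rule DERIV_unique) (rule DERIV_const)
  ultimately show ?case
    by (simp add: DERIV_imp_deriv complex_eq_iff)
qed

lemma higher_deriv_exp_linear: "(deriv ^^ n) (\<lambda>w. exp (c * w)) 0 = c ^ n" for c :: complex
proof -
  have "(deriv ^^ n) exp = (exp :: complex \<Rightarrow> complex)"
    by (induction n) (auto intro!: ext DERIV_imp_deriv)
  then show ?thesis
    using higher_deriv_compose_linear [of exp UNIV UNIV 0 c n] by (simp add: holomorphic_on_exp)
qed

text \<open>The kernel of the Bargmann transform. It is the generating function of the Hermite functions; up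
  to a scalar, each \<open>coherent w\<close> is a time-frequency shift of the Gaussian \<open>hermite1 0\<close>.\<close>

definition coherent :: "complex \<Rightarrow> real \<Rightarrow> complex" where
  "coherent w t = of_real (2 powr (1/4)) * exp (of_real pi * (2 * of_real t * w - w\<^sup>2 / 2 - (of_real t)\<^sup>2))"

lemma coherent_holomorphic [holomorphic_intros]: "(\<lambda>w. coherent w t) holomorphic_on S"
  unfolding coherent_def by (intro holomorphic_intros) auto

lemma coherent_measurable [measurable]:
  assumes "f \<in> borel_measurable M" "g \<in> borel_measurable M"
  shows "(\<lambda>x. coherent (f x) (g x)) \<in> borel_measurable M"
  unfolding coherent_def using assms by measurable

text \<open>Completing the square, \<open>coherent w t\<close> is \<open>exp (pi * t\<^sup>2)\<close> times the Gaussian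
  \<open>exp (- 2 * pi * s\<^sup>2)\<close> at \<open>s = t - w / 2\<close>, so differentiating in \<open>w\<close> gives the Rodrigues formula.\<close>

lemma hermite1_conv_coherent:
  "complex_of_real (hermite1 n t) = (deriv ^^ n) (\<lambda>w. coherent w t) 0 / of_real (sqrt (fact n * pi ^ n))"
proof -
  define f where "f = (\<lambda>z. exp (- 2 * of_real pi * z\<^sup>2) :: complex)"
  have f: "f holomorphic_on S" for S
    unfolding f_def by (intro holomorphic_intros)
  have h: "(\<lambda>w. f ((-1/2) * w + of_real t)) holomorphic_on UNIV"
    by (rule holomorphic_on_compose_gen [OF _ f, unfolded o_def, of _ _ UNIV]) (auto intro!: holomorphic_intros)
  have "coherent w t = of_real (2 powr (1/4) * exp (pi * t\<^sup>2)) * f ((-1/2) * w + of_real t)" for w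
    unfolding coherent_def f_def
    by (simp add: exp_of_real [symmetric] exp_add [symmetric] mult_ac)
       (simp add: power2_eq_square algebra_simps)
  then have "(deriv ^^ n) (\<lambda>w. coherent w t) 0
      = (deriv ^^ n) (\<lambda>w. of_real (2 powr (1/4) * exp (pi * t\<^sup>2)) * f ((-1/2) * w + of_real t)) 0"
    by (simp only:)
  also have "\<dots> = of_real (2 powr (1/4) * exp (pi * t\<^sup>2)) * (deriv ^^ n) (\<lambda>w. f ((-1/2) * w + of_real t)) 0"
    by (rule higher_deriv_cmult [of _ UNIV]) (rule h | simp)+
  also have "(deriv ^^ n) (\<lambda>w. f ((-1/2) * w + of_real t)) 0 = (-1/2) ^ n * (deriv ^^ n) f (of_real t)"
    using higher_deriv_compose_linear' [OF f [of UNIV], of UNIV 0 "-1/2" "of_real t" n] by simp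
  also have "(deriv ^^ n) f (of_real t) = of_real ((deriv ^^ n) (\<lambda>s. exp (- 2 * pi * s\<^sup>2)) t)"
    by (rule higher_deriv_of_real [OF f]) (simp add: f_def exp_of_real [symmetric])
  finally have D: "(deriv ^^ n) (\<lambda>w. coherent w t) 0 = of_real (2 powr (1/4) * exp (pi * t\<^sup>2) *
      ((-1/2) ^ n * (deriv ^^ n) (\<lambda>s. exp (- 2 * pi * s\<^sup>2)) t))"
    by simp
  have "(- 1 / (2 * sqrt pi)) ^ n = (- 1 / 2) ^ n / sqrt (pi ^ n)"
  proof -
    have "- 1 / (2 * sqrt pi) = (- 1 / 2) / sqrt pi" by simp
    then show ?thesis by (simp only: power_divide real_sqrt_power)
  qed
  then have "hermite1 n t = 2 powr (1/4) * exp (pi * t\<^sup>2) *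
      ((-1/2) ^ n * (deriv ^^ n) (\<lambda>s. exp (- 2 * pi * s\<^sup>2)) t) / sqrt (fact n * pi ^ n)"
    by (simp add: hermite1_def real_sqrt_mult)
  then show ?thesis by (simp add: D)
qed

lemma norm_coherent:
  "norm (coherent w t) = 2 powr (1/4) * exp (pi * (2 * t * Re w - Re (w\<^sup>2) / 2 - t\<^sup>2))"
  by (simp add: coherent_def norm_mult)

text \<open>A bound that is locally uniform in \<open>w\<close>; with Cauchy's formula it passes to the Taylor
  coefficients and so shows that Hermite functions decay like a Gaussian.\<close>

lemma norm_coherent_le:
  "norm (coherent w t) \<le> 2 powr (1/4) * exp (5/2 * pi * (norm w)\<^sup>2) * exp (- (pi * t\<^sup>2 / 2))"
proof -
  have "\<bar>Re (w\<^sup>2)\<bar> \<le> (norm w)\<^sup>2"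
    using abs_Re_le_cmod [of "w\<^sup>2"] by (simp add: norm_power)
  moreover have "2 * t * Re w \<le> t\<^sup>2 / 2 + 2 * (Re w)\<^sup>2"
    using zero_le_power2 [of "t - 2 * Re w"] by (simp add: power2_eq_square algebra_simps)
  moreover have "(Re w)\<^sup>2 \<le> (norm w)\<^sup>2"
    by (simp add: cmod_power2)
  ultimately have "2 * t * Re w - Re (w\<^sup>2) / 2 - t\<^sup>2 \<le> 5/2 * (norm w)\<^sup>2 - t\<^sup>2 / 2"
    by linarith
  then have "pi * (2 * t * Re w - Re (w\<^sup>2) / 2 - t\<^sup>2) \<le> pi * (5/2 * (norm w)\<^sup>2 - t\<^sup>2 / 2)"
    by (intro mult_left_mono) auto
  also have "\<dots> = 5/2 * pi * (norm w)\<^sup>2 + - (pi * t\<^sup>2 / 2)"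
    by (simp add: algebra_simps)
  finally have "exp (pi * (2 * t * Re w - Re (w\<^sup>2) / 2 - t\<^sup>2)) \<le> exp (5/2 * pi * (norm w)\<^sup>2) * exp (- (pi * t\<^sup>2 / 2))"
    unfolding exp_add [symmetric] by simp
  then show ?thesis by (simp add: norm_coherent mult.assoc)
qed

text \<open>The real part of \<open>s\<close> is removed by translation; the imaginary part enters as the argument of the
  characteristic function of the normal distribution.\<close>

lemma complex_gaussian_integral:
  fixes s :: complex
  shows "has_bochner_integral lborel (\<lambda>t. of_real (sqrt 2) * exp (- 2 * of_real pi * (of_real t - s)\<^sup>2)) 1"
proof -
  define a b where "a = Re s" and "b = Im s"
  have s: "s = of_real a + \<i> * of_real b" by (simp add: a_def b_def complex_eq)
  define g where "g = (\<lambda>x. std_normal_density x *\<^sub>R iexp (2 * sqrt pi * b * x))"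
  have g: "has_bochner_integral lborel g (of_real (exp (- (2 * pi * b\<^sup>2))))"
  proof -
    have "integral\<^sup>L lborel g = (\<integral>x. iexp (2 * sqrt pi * b * x) \<partial>std_normal_distribution)"
      unfolding g_def by (subst integral_density) auto
    also have "\<dots> = char std_normal_distribution (2 * sqrt pi * b)"
      by (simp add: char_def)
    also have "\<dots> = of_real (exp (- (2 * pi * b\<^sup>2)))"
      by (simp add: char_std_normal_distribution power_mult_distrib)
    finally have I: "integral\<^sup>L lborel g = of_real (exp (- (2 * pi * b\<^sup>2)))" .
    have "integrable lborel g"
    proof (rule Bochner_Integration.integrable_bound)
      show "integrable lborel std_normal_density" by simp
      show "g \<in> borel_measurable lborel" unfolding g_def by measurable
      show "AE x in lborel. norm (g x) \<le> norm (std_normal_density x)"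
        by (simp add: g_def)
    qed
    with I show ?thesis by (metis has_bochner_integral_integrable)
  qed
  \<comment> \<open>The substitution that turns the variance of the standard normal density into that of
    the Gaussian in question.\<close>
  define c where "c = 2 * sqrt pi"
  have c: "c \<noteq> 0" "c > 0" by (auto simp: c_def)
  have "integrable lborel (\<lambda>t. g (- c * a + c * t))"
    using g c by (subst lborel_integrable_real_affine_iff) (auto simp: has_bochner_integral_iff)
  moreover have "integral\<^sup>L lborel g = \<bar>c\<bar> *\<^sub>R (\<integral>t. g (- c * a + c * t) \<partial>lborel)"
    by (rule lborel_integral_real_affine) (use c in auto)
  ultimately have "has_bochner_integral lborel (\<lambda>t. g (- c * a + c * t)) (of_real (exp (- (2 * pi * b\<^sup>2)) / c))"
    using g c by (auto simp: has_bochner_integral_iff scaleR_conv_of_real field_simps)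
  then have "has_bochner_integral lborel (\<lambda>t. of_real (c * exp (2 * pi * b\<^sup>2)) * g (- c * a + c * t))
      (of_real (c * exp (2 * pi * b\<^sup>2)) * of_real (exp (- (2 * pi * b\<^sup>2)) / c))"
    by (rule has_bochner_integral_mult_right)
  moreover have "of_real (c * exp (2 * pi * b\<^sup>2)) * of_real (exp (- (2 * pi * b\<^sup>2)) / c) = (1::complex)"
  proof -
    have "(c * exp (2 * pi * b\<^sup>2)) * (exp (- (2 * pi * b\<^sup>2)) / c) = 1"
      using c by (simp add: exp_minus)
    then show ?thesis by (metis of_real_1 of_real_mult)
  qed
  moreover have "of_real (c * exp (2 * pi * b\<^sup>2)) * g (- c * a + c * t)
      = of_real (sqrt 2) * exp (- 2 * of_real pi * (of_real t - s)\<^sup>2)" for t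
  proof -
    have c2: "c\<^sup>2 = 4 * pi" by (simp add: c_def power_mult_distrib)
    have "(- c * a + c * t)\<^sup>2 = c\<^sup>2 * (t - a)\<^sup>2"
      by (simp add: power2_eq_square algebra_simps)
    then have 1: "std_normal_density (- c * a + c * t) = 1 / sqrt (2 * pi) * exp (- (2 * pi * (t - a)\<^sup>2))"
      by (simp add: std_normal_density_def c2)
    have "2 * sqrt pi * b * (- c * a + c * t) = c\<^sup>2 * b * (t - a)"
      by (simp add: c_def power2_eq_square algebra_simps)
    then have 2: "iexp (2 * sqrt pi * b * (- c * a + c * t)) = exp (\<i> * of_real (4 * pi * b * (t - a)))"
      by (simp only: c2)
    have 3: "c * (1 / sqrt (2 * pi)) = sqrt 2"
      by (simp add: c_def real_sqrt_mult real_div_sqrt)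
    have "of_real (c * exp (2 * pi * b\<^sup>2)) * g (- c * a + c * t)
       = of_real (c * (1 / sqrt (2 * pi))) * (of_real (exp (2 * pi * b\<^sup>2)) * of_real (exp (- (2 * pi * (t - a)\<^sup>2)))
           * exp (\<i> * of_real (4 * pi * b * (t - a))))"
      unfolding g_def 1 2 by (simp add: scaleR_conv_of_real)
    also have "\<dots> = of_real (sqrt 2) * exp (of_real (2 * pi * b\<^sup>2) + of_real (- (2 * pi * (t - a)\<^sup>2))
           + \<i> * of_real (4 * pi * b * (t - a)))"
      unfolding 3 exp_add exp_of_real ..
    also have "of_real (2 * pi * b\<^sup>2) + of_real (- (2 * pi * (t - a)\<^sup>2)) + \<i> * of_real (4 * pi * b * (t - a))
       = - 2 * of_real pi * (of_real t - s)\<^sup>2"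
      by (simp add: s complex_eq_iff power2_eq_square algebra_simps)
    finally show ?thesis .
  qed
  ultimately show ?thesis by simp
qed

text \<open>The orthonormality of the Hermite functions in generating-function form.\<close>

lemma coherent_product_integral:
  "has_bochner_integral lborel (\<lambda>t. coherent v t * coherent w t) (exp (of_real pi * v * w))"
proof -
  have sqrt2: "complex_of_real (2 powr (1/4)) * of_real (2 powr (1/4)) = of_real (sqrt 2)"
    by (simp flip: of_real_mult powr_add add: powr_half_sqrt)
  have "coherent v t * coherent w t = exp (of_real pi * v * w) *
      (of_real (sqrt 2) * exp (- 2 * of_real pi * (of_real t - (v + w) / 2)\<^sup>2))" for t
  proof -
    have "coherent v t * coherent w t = of_real (sqrt 2) *
       exp (of_real pi * (2 * of_real t * v - v\<^sup>2 / 2 - (of_real t)\<^sup>2) + of_real pi * (2 * of_real t * w - w\<^sup>2 / 2 - (of_real t)\<^sup>2))"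
      unfolding coherent_def exp_add sqrt2 [symmetric] by (simp only: mult_ac)
    also have "of_real pi * (2 * of_real t * v - v\<^sup>2 / 2 - (of_real t)\<^sup>2) + of_real pi * (2 * of_real t * w - w\<^sup>2 / 2 - (of_real t)\<^sup>2)
      = of_real pi * v * w + (- 2 * of_real pi * (of_real t - (v + w) / 2)\<^sup>2)"
      by (simp add: power2_eq_square field_simps)
    finally show ?thesis unfolding exp_add by (simp only: mult_ac)
  qed
  then show ?thesis
    using has_bochner_integral_mult_right [OF complex_gaussian_integral [of "(v + w) / 2"], of "exp (of_real pi * v * w)"]
    by simp
qed

lemma integrable_gaussian: "integrable lborel (\<lambda>t. exp (- (pi * t\<^sup>2 / 2)))"
proof -
  have "integrable lborel (\<lambda>t. of_real (sqrt 2) * exp (- 2 * of_real pi * (of_real t - 0)\<^sup>2) :: complex)"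
    using complex_gaussian_integral [of 0] by (simp only: has_bochner_integral_iff)
  from integrable_norm [OF this] have "integrable lborel (\<lambda>t. exp (- (2 * pi * t\<^sup>2)))"
    by (simp add: norm_mult norm_exp power2_eq_square flip: of_real_mult)
  then have "integrable lborel (\<lambda>t. exp (- (2 * pi * (0 + 1/2 * t)\<^sup>2)))"
    by (subst lborel_integrable_real_affine_iff) auto
  then show ?thesis by (simp add: power_divide field_simps)
qed

lemma coherent_integrable: "integrable lborel (coherent w)"
proof (rule Bochner_Integration.integrable_bound)
  show "integrable lborel (\<lambda>t. 2 powr (1/4) * exp (5/2 * pi * (norm w)\<^sup>2) * exp (- (pi * t\<^sup>2 / 2)))"
    by (rule integrable_mult_right [OF integrable_gaussian])
  show "AE t in lborel. norm (coherent w t) \<le> norm (2 powr (1/4) * exp (5/2 * pi * (norm w)\<^sup>2) * exp (- (pi * t\<^sup>2 / 2)))"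
    using norm_coherent_le [of w] by simp
qed measurable

lemma coherent_deriv_eq_circle_mean:
  "(deriv ^^ k) (\<lambda>w. coherent w t) 0
    = fact k * (\<integral>\<theta>. coherent (cis \<theta>) t * cis (- (real k * \<theta>)) \<partial>circle_measure)"
  using circle_mean_holomorphic [of "\<lambda>w. coherent w t" 1 "int k"] by (simp add: coherent_holomorphic)

lemma norm_coherent_deriv_le:
  "norm ((deriv ^^ k) (\<lambda>w. coherent w t) 0)
    \<le> fact k * (2 powr (1/4) * exp (5/2 * pi)) * exp (- (pi * t\<^sup>2 / 2))"
proof -
  have "norm (\<integral>\<theta>. coherent (cis \<theta>) t * cis (- (real k * \<theta>)) \<partial>circle_measure)
      \<le> (\<integral>\<theta>. 2 powr (1/4) * exp (5/2 * pi) * exp (- (pi * t\<^sup>2 / 2)) \<partial>circle_measure)"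
  proof (rule Bochner_Integration.integral_norm_bound_integral)
    have bd: "norm (coherent (cis \<theta>) t * cis (- (real k * \<theta>))) \<le> 2 powr (1/4) * exp (5/2 * pi) * exp (- (pi * t\<^sup>2 / 2))" for \<theta>
      using norm_coherent_le [of "cis \<theta>" t] by (simp add: norm_mult)
    then show "norm (coherent (cis \<theta>) t * cis (- (real k * \<theta>))) \<le> 2 powr (1/4) * exp (5/2 * pi) * exp (- (pi * t\<^sup>2 / 2))" for \<theta> .
    show "integrable circle_measure (\<lambda>\<theta>. coherent (cis \<theta>) t * cis (- (real k * \<theta>)))"
      by (rule circle.integrable_const_bound [OF always_eventually]) (use bd in auto)
  qed simp
  then show ?thesis
    by (simp add: coherent_deriv_eq_circle_mean norm_mult mult.assoc circle.prob_space [simplified])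
qed

lemma coherent_deriv_measurable [measurable]:
  "(\<lambda>t. (deriv ^^ k) (\<lambda>w. coherent w t) 0) \<in> borel_measurable borel"
  unfolding coherent_deriv_eq_circle_mean by measurable

lemma hermite1_measurable [measurable]: "hermite1 n \<in> borel_measurable borel"
proof -
  have "(\<lambda>t. Re (complex_of_real (hermite1 n t))) \<in> borel_measurable borel"
    unfolding hermite1_conv_coherent by measurable
  then show ?thesis by simp
qed

lemma hermite1_bound:
  obtains C where "C \<ge> 0" "\<And>t. \<bar>hermite1 n t\<bar> \<le> C * exp (- (pi * t\<^sup>2 / 2))"
proof
  let ?C = "fact n * (2 powr (1/4) * exp (5/2 * pi)) / sqrt (fact n * pi ^ n)"
  show "?C \<ge> 0" by simp
  fix t
  have "\<bar>hermite1 n t\<bar> = norm (complex_of_real (hermite1 n t))" by simp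
  also have "\<dots> = norm ((deriv ^^ n) (\<lambda>w. coherent w t) 0) / sqrt (fact n * pi ^ n)"
    unfolding hermite1_conv_coherent by (simp add: norm_divide)
  also have "\<dots> \<le> fact n * (2 powr (1/4) * exp (5/2 * pi)) * exp (- (pi * t\<^sup>2 / 2)) / sqrt (fact n * pi ^ n)"
    by (intro divide_right_mono norm_coherent_deriv_le) simp
  finally show "\<bar>hermite1 n t\<bar> \<le> ?C * exp (- (pi * t\<^sup>2 / 2))" by simp
qed

lemma hermite1_integrable: "integrable lborel (hermite1 n)"
proof -
  obtain C where C: "C \<ge> 0" "\<And>t. \<bar>hermite1 n t\<bar> \<le> C * exp (- (pi * t\<^sup>2 / 2))"
    using hermite1_bound [of n] by blast
  show ?thesis
    by (rule Bochner_Integration.integrable_bound [OF integrable_mult_right [OF integrable_gaussian, of C]])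
       (use C in auto)
qed

lemma hermite1_bounded:
  obtains C where "C \<ge> 0" "\<And>t. \<bar>hermite1 n t\<bar> \<le> C"
proof -
  obtain C where C: "C \<ge> 0" "\<And>t. \<bar>hermite1 n t\<bar> \<le> C * exp (- (pi * t\<^sup>2 / 2))"
    using hermite1_bound [of n] by blast
  have "C * exp (- (pi * t\<^sup>2 / 2)) \<le> C * 1" for t :: real
    using C(1) by (intro mult_left_mono) auto
  with C that show ?thesis by (metis mult.right_neutral order_trans)
qed

lemma hermite1_square_integrable: "integrable lborel (\<lambda>t. (hermite1 n t)\<^sup>2)"
proof -
  obtain C where C: "C \<ge> 0" "\<And>t. \<bar>hermite1 n t\<bar> \<le> C"
    using hermite1_bounded [of n] by blast
  have "norm ((hermite1 n t)\<^sup>2) \<le> norm (C * hermite1 n t)" for t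
  proof -
    have "\<bar>hermite1 n t\<bar> * \<bar>hermite1 n t\<bar> \<le> C * \<bar>hermite1 n t\<bar>"
      using C by (intro mult_right_mono) auto
    then show ?thesis using C(1) by (simp add: power2_eq_square abs_mult)
  qed
  then show ?thesis
    by (intro Bochner_Integration.integrable_bound [OF integrable_mult_right [OF hermite1_integrable, of C]]) auto
qed

text \<open>Taylor coefficients in \<open>w\<close> may be taken under the integral sign. They are means over the unit
  circle, where \<open>coherent\<close> is bounded, so this is Fubini's theorem.\<close>

lemma integral_coherent_deriv:
  fixes f :: "real \<Rightarrow> complex"
  assumes f: "integrable lborel f" and G: "G holomorphic_on UNIV"
    and fG: "\<And>w. norm w = 1 \<Longrightarrow> (\<integral>t. f t * coherent w t \<partial>lborel) = G w"
  shows "(\<integral>t. f t * (deriv ^^ k) (\<lambda>w. coherent w t) 0 \<partial>lborel) = (deriv ^^ k) G 0"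
proof -
  interpret pair_sigma_finite lborel circle_measure
    by (intro pair_sigma_finite.intro sigma_finite_lborel circle.sigma_finite_measure_axioms)
  have [measurable]: "f \<in> borel_measurable borel"
    using borel_measurable_integrable [OF f] by simp
  define M where "M = 2 powr (1/4) * exp (5/2 * pi)"
  have M: "norm (coherent (cis \<theta>) t) \<le> M" for \<theta> t
  proof -
    have "norm (coherent (cis \<theta>) t) \<le> M * exp (- (pi * t\<^sup>2 / 2))"
      using norm_coherent_le [of "cis \<theta>" t] by (simp add: M_def)
    also have "\<dots> \<le> M * 1"
      by (intro mult_left_mono) (auto simp: M_def)
    finally show ?thesis by simp
  qed
  have int: "integrable (lborel \<Otimes>\<^sub>M circle_measure)
      (\<lambda>(t, \<theta>). f t * (coherent (cis \<theta>) t * cis (- (real k * \<theta>))))"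
  proof (rule Bochner_Integration.integrable_bound)
    show "integrable (lborel \<Otimes>\<^sub>M circle_measure) (\<lambda>(t, \<theta>). M * norm (f t))"
      using f by (intro Fubini_integrable) (auto simp: circle.prob_space)
    have "norm (f t) * norm (coherent (cis \<theta>) t) \<le> \<bar>M\<bar> * norm (f t)" for t \<theta>
      using mult_left_mono [OF M [of \<theta> t] norm_ge_zero [of "f t"]] mult_right_mono [OF abs_ge_self [of M] norm_ge_zero [of "f t"]]
      by (simp add: mult.commute)
    then show "AE x in lborel \<Otimes>\<^sub>M circle_measure. norm (case x of (t, \<theta>) \<Rightarrow> f t * (coherent (cis \<theta>) t * cis (- (real k * \<theta>))))
       \<le> norm (case x of (t, \<theta>) \<Rightarrow> M * norm (f t))"
      by (auto simp: norm_mult abs_mult)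
  qed measurable
  have "(\<integral>t. f t * (deriv ^^ k) (\<lambda>w. coherent w t) 0 \<partial>lborel)
      = fact k * (\<integral>t. (\<integral>\<theta>. f t * (coherent (cis \<theta>) t * cis (- (real k * \<theta>))) \<partial>circle_measure) \<partial>lborel)"
    by (simp add: coherent_deriv_eq_circle_mean mult.left_commute)
  also have "(\<integral>t. (\<integral>\<theta>. f t * (coherent (cis \<theta>) t * cis (- (real k * \<theta>))) \<partial>circle_measure) \<partial>lborel)
      = (\<integral>\<theta>. (\<integral>t. f t * (coherent (cis \<theta>) t * cis (- (real k * \<theta>))) \<partial>lborel) \<partial>circle_measure)"
    by (rule Fubini_integral [OF int, symmetric])
  also have "\<dots> = (\<integral>\<theta>. (\<integral>t. f t * coherent (cis \<theta>) t \<partial>lborel) * cis (- (real k * \<theta>)) \<partial>circle_measure)"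
    by (simp flip: mult.assoc)
  also have "\<dots> = (\<integral>\<theta>. G (cis \<theta>) * cis (- (real k * \<theta>)) \<partial>circle_measure)"
    by (simp add: fG)
  also have "fact k * \<dots> = (deriv ^^ k) G 0"
    using circle_mean_holomorphic [OF G, of 1 "int k"] by simp
  finally show ?thesis .
qed

text \<open>The Bargmann transform sends Hermite functions to normalised monomials.\<close>

lemma hermite1_bargmann:
  "(\<integral>t. of_real (hermite1 n t) * coherent u t \<partial>lborel) = of_real (sqrt (pi ^ n / fact n)) * u ^ n"
proof -
  \<comment> \<open>The Bargmann transform of \<open>coherent u\<close>.\<close>
  define G where "G = (\<lambda>w. exp (of_real pi * u * w))"
  have "(\<integral>t. coherent u t * (deriv ^^ n) (\<lambda>w. coherent w t) 0 \<partial>lborel) = (deriv ^^ n) G 0"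
    using coherent_product_integral [of u]
    by (intro integral_coherent_deriv coherent_integrable) (auto simp: G_def has_bochner_integral_iff intro!: holomorphic_intros)
  also have "(deriv ^^ n) G 0 = (of_real pi * u) ^ n"
    unfolding G_def by (rule higher_deriv_exp_linear)
  finally have 1: "(\<integral>t. coherent u t * (deriv ^^ n) (\<lambda>w. coherent w t) 0 \<partial>lborel) = (of_real pi * u) ^ n" .
  have "(\<integral>t. of_real (hermite1 n t) * coherent u t \<partial>lborel)
      = (\<integral>t. coherent u t * (deriv ^^ n) (\<lambda>w. coherent w t) 0 / of_real (sqrt (fact n * pi ^ n)) \<partial>lborel)"
    unfolding hermite1_conv_coherent by (simp add: mult.commute)
  also have "\<dots> = (of_real pi * u) ^ n / of_real (sqrt (fact n * pi ^ n))"
    using 1 by simp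
  also have "\<dots> = of_real (pi ^ n / sqrt (fact n * pi ^ n)) * u ^ n"
    by (simp add: power_mult_distrib)
  also have "pi ^ n / sqrt (fact n * pi ^ n) = sqrt (pi ^ n / fact n)"
    by (simp add: real_sqrt_mult real_sqrt_divide field_simps)
  finally show ?thesis .
qed

section \<open>Time-frequency shifts of a Hermite function\<close>

text \<open>One coordinate factor of \<open>tf_shift\<close>.\<close>

definition shift1 :: "complex \<Rightarrow> (real \<Rightarrow> complex) \<Rightarrow> real \<Rightarrow> complex" where
  "shift1 z g t = exp (2 * of_real pi * \<i> * of_real (t * Im z)) * g (t - Re z)"

text \<open>The scalar by which a shift of the Gaussian differs from \<open>coherent z\<close>. Its modulus is the
  Gaussian weight of phase space; its phase cancels in the product of a transform with a shift.\<close>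

definition weyl_factor :: "complex \<Rightarrow> complex" where
  "weyl_factor z = exp (of_real pi * (\<i> * of_real (Re z * Im z) - of_real ((norm z)\<^sup>2 / 2)))"

lemma norm_weyl_factor: "norm (weyl_factor z) = exp (- (pi * (norm z)\<^sup>2 / 2))"
  by (simp add: weyl_factor_def)

text \<open>Shifts act on the generating function by translation of its parameter.\<close>

lemma shift1_coherent:
  "shift1 z (coherent w) t = weyl_factor z * exp (- (of_real pi * cnj z * w)) * coherent (z + w) t"
proof -
  have "shift1 z (coherent w) t = of_real (2 powr (1/4)) * exp (2 * of_real pi * \<i> * of_real (t * Im z)
      + of_real pi * (2 * of_real (t - Re z) * w - w\<^sup>2 / 2 - (of_real (t - Re z))\<^sup>2))"
    unfolding shift1_def coherent_def exp_add by (simp only: mult_ac)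
  also have "2 * of_real pi * \<i> * of_real (t * Im z)
      + of_real pi * (2 * of_real (t - Re z) * w - w\<^sup>2 / 2 - (of_real (t - Re z))\<^sup>2)
    = of_real pi * (\<i> * of_real (Re z * Im z) - of_real ((norm z)\<^sup>2 / 2)) + - (of_real pi * cnj z * w)
      + of_real pi * (2 * of_real t * (z + w) - (z + w)\<^sup>2 / 2 - (of_real t)\<^sup>2)"
    unfolding cmod_power2 by (simp add: complex_eq_iff power2_eq_square field_simps)
  finally show ?thesis
    unfolding weyl_factor_def coherent_def exp_add by (simp only: mult_ac)
qed

text \<open>Leibniz' rule for the \<open>k\<close>-th derivative at \<open>w = 0\<close> in \<open>shift1_coherent\<close>. The dependence on \<open>z\<close> is
  now entire apart from powers of \<open>cnj z\<close>.\<close>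

lemma shift1_hermite1:
  "shift1 z (\<lambda>t. of_real (hermite1 k t)) t = weyl_factor z / of_real (sqrt (fact k * pi ^ k)) *
     (\<Sum>i\<le>k. of_nat (k choose i) * (- (of_real pi * cnj z)) ^ i * (deriv ^^ (k - i)) (\<lambda>w. coherent w t) z)"
proof -
  let ?E = "\<lambda>w. exp (- (of_real pi * cnj z) * w)"
  have hE: "?E holomorphic_on UNIV" by (intro holomorphic_intros)
  have hC: "(\<lambda>w. coherent (z + w) t) holomorphic_on UNIV"
    unfolding coherent_def by (intro holomorphic_intros) auto
  have hEC: "(\<lambda>w. ?E w * coherent (z + w) t) holomorphic_on UNIV"
    by (intro holomorphic_on_mult hE hC)
  have "exp (2 * of_real pi * \<i> * of_real (t * Im z)) * (deriv ^^ k) (\<lambda>w. coherent w (t - Re z)) 0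
      = (deriv ^^ k) (\<lambda>w. shift1 z (coherent w) t) 0"
    unfolding shift1_def
    by (rule higher_deriv_cmult [OF coherent_holomorphic, of _ UNIV, symmetric]) auto
  also have "(\<lambda>w. shift1 z (coherent w) t) = (\<lambda>w. weyl_factor z * (?E w * coherent (z + w) t))"
    unfolding shift1_coherent by (simp add: mult.assoc)
  also have "(deriv ^^ k) (\<lambda>w. weyl_factor z * (?E w * coherent (z + w) t)) 0
      = weyl_factor z * (deriv ^^ k) (\<lambda>w. ?E w * coherent (z + w) t) 0"
    by (rule higher_deriv_cmult [OF hEC]) auto
  also have "(deriv ^^ k) (\<lambda>w. ?E w * coherent (z + w) t) 0
      = (\<Sum>i=0..k. of_nat (k choose i) * (deriv ^^ i) ?E 0 * (deriv ^^ (k - i)) (\<lambda>w. coherent (z + w) t) 0)"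
    by (rule higher_deriv_mult [OF hE hC]) auto
  also have "\<dots> = (\<Sum>i\<le>k. of_nat (k choose i) * (- (of_real pi * cnj z)) ^ i * (deriv ^^ (k - i)) (\<lambda>w. coherent w t) z)"
  proof (rule sum.cong)
    fix i
    have "(deriv ^^ i) ?E 0 = (- (of_real pi * cnj z)) ^ i"
      by (rule higher_deriv_exp_linear)
    moreover have "(deriv ^^ j) (\<lambda>w. coherent (z + w) t) 0 = (deriv ^^ j) (\<lambda>w. coherent w t) z" for j
      using higher_deriv_compose_linear' [OF coherent_holomorphic [of t UNIV] open_UNIV open_UNIV, of 0 1 z j]
      by (simp add: add.commute)
    ultimately show "of_nat (k choose i) * (deriv ^^ i) ?E 0 * (deriv ^^ (k - i)) (\<lambda>w. coherent (z + w) t) 0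
       = of_nat (k choose i) * (- (of_real pi * cnj z)) ^ i * (deriv ^^ (k - i)) (\<lambda>w. coherent w t) z"
      by simp
  qed auto
  finally show ?thesis
    unfolding shift1_def hermite1_conv_coherent by (simp add: field_simps)
qed

text \<open>The polynomial part of a special Hermite function. For \<open>n < k - i\<close> the binomial coefficient is
  \<open>0\<close>, so truncated subtraction in the exponent does no harm.\<close>

definition overlap_poly :: "nat \<Rightarrow> nat \<Rightarrow> complex \<Rightarrow> complex" where
  "overlap_poly n k z =
     (\<Sum>i\<le>k. (- (of_real pi * cnj z)) ^ i / fact i * of_nat (n choose (k - i)) * z ^ (n - (k - i)))"

lemma pochhammer_choose:
  "pochhammer (of_nat (Suc n - j)) j = (fact j * of_nat (n choose j) :: complex)"
proof (cases "j \<le> n")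
  case True
  then show ?thesis
    using gbinomial_pochhammer' [of "of_nat n :: complex" j]
    by (simp add: binomial_gbinomial of_nat_diff Suc_diff_le algebra_simps)
next
  case False
  then have "Suc n - j = 0" "j > 0" by auto
  then show ?thesis using False by (simp add: pochhammer_0_left binomial_eq_0)
qed

text \<open>The complex conjugate of the one-dimensional transform of \<open>hermite1 n\<close> with window \<open>hermite1 k\<close>;
  unlike the transform itself, it contains \<open>shift1\<close> without conjugation.\<close>

definition overlap1 :: "nat \<Rightarrow> nat \<Rightarrow> complex \<Rightarrow> complex" where
  "overlap1 n k z = (\<integral>t. of_real (hermite1 n t) * shift1 z (\<lambda>t. of_real (hermite1 k t)) t \<partial>lborel)"

text \<open>The \<open>k\<close>-th Taylor coefficient in \<open>w\<close> of the Bargmann transform of the back-shifted \<open>hermite1 n\<close>,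
  which is an explicit exponential times a power of \<open>z + w\<close>.\<close>

lemma overlap1_eq:
  "overlap1 n k z = of_real (sqrt (fact k * pi ^ n / (fact n * pi ^ k))) * weyl_factor z * overlap_poly n k z"
proof -
  \<comment> \<open>\<open>hermite1 n\<close> with the shift moved over from the other factor.\<close>
  define f where "f = (\<lambda>t. of_real (hermite1 n (t + Re z)) * exp (2 * of_real pi * \<i> * of_real ((t + Re z) * Im z)))"
  define c where "c = weyl_factor z * of_real (sqrt (pi ^ n / fact n))"
  define E where "E = (\<lambda>w. exp (- (of_real pi * cnj z) * w))"
  define G where "G = (\<lambda>w. c * (E w * (w - - z) ^ n))"
  have hE: "E holomorphic_on UNIV" unfolding E_def by (intro holomorphic_intros)
  have hP: "(\<lambda>w. (w - - z) ^ n) holomorphic_on UNIV" by (intro holomorphic_intros)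
  have f: "integrable lborel f"
  proof (rule Bochner_Integration.integrable_bound)
    show "integrable lborel (\<lambda>t. hermite1 n (Re z + 1 * t))"
      by (subst lborel_integrable_real_affine_iff) (auto simp: hermite1_integrable)
    show "f \<in> borel_measurable lborel" unfolding f_def by measurable
    show "AE t in lborel. norm (f t) \<le> norm (hermite1 n (Re z + 1 * t))"
      by (simp add: f_def norm_mult add.commute)
  qed
  have shift: "(\<integral>t. f t * h t \<partial>lborel) = (\<integral>t. of_real (hermite1 n t) * shift1 z h t \<partial>lborel)" for h
    using lborel_integral_real_affine [of 1 "\<lambda>t. of_real (hermite1 n t) * shift1 z h t" "Re z"]
    by (simp add: f_def shift1_def algebra_simps)
  have "(\<integral>t. f t * coherent w t \<partial>lborel) = G w" for w
  proof -
    have "(\<integral>t. f t * coherent w t \<partial>lborel) = (\<integral>t. weyl_factor z * E w * (of_real (hermite1 n t) * coherent (z + w) t) \<partial>lborel)"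
      unfolding shift shift1_coherent E_def by (simp add: mult_ac)
    also have "\<dots> = weyl_factor z * E w * (\<integral>t. of_real (hermite1 n t) * coherent (z + w) t \<partial>lborel)"
      by (rule integral_mult_right_zero)
    also have "\<dots> = G w"
      by (simp add: hermite1_bargmann G_def c_def add.commute)
    finally show ?thesis .
  qed
  then have "(\<integral>t. f t * (deriv ^^ k) (\<lambda>w. coherent w t) 0 \<partial>lborel) = (deriv ^^ k) G 0"
    by (intro integral_coherent_deriv f) (auto simp: G_def intro!: holomorphic_intros hE)
  also have "(deriv ^^ k) G 0 = c * (deriv ^^ k) (\<lambda>w. E w * (w - - z) ^ n) 0"
    unfolding G_def by (rule higher_deriv_cmult [OF holomorphic_on_mult [OF hE hP]]) auto
  also have "(deriv ^^ k) (\<lambda>w. E w * (w - - z) ^ n) 0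
      = (\<Sum>i=0..k. of_nat (k choose i) * (deriv ^^ i) E 0 * (deriv ^^ (k - i)) (\<lambda>w. (w - - z) ^ n) 0)"
    by (rule higher_deriv_mult [OF hE hP]) auto
  also have "\<dots> = (\<Sum>i\<le>k. fact k * ((- (of_real pi * cnj z)) ^ i / fact i * of_nat (n choose (k - i)) * z ^ (n - (k - i))))"
  proof (rule sum.cong)
    fix i assume "i \<in> {..k}"
    then have i: "i \<le> k" by simp
    have 1: "(deriv ^^ i) E 0 = (- (of_real pi * cnj z)) ^ i"
      unfolding E_def by (rule higher_deriv_exp_linear)
    have 2: "of_nat (k choose i) = (fact k / (fact i * fact (k - i)) :: complex)"
      using i by (rule binomial_fact)
    have 3: "(deriv ^^ (k - i)) (\<lambda>w. (w - - z) ^ n) 0 = fact (k - i) * of_nat (n choose (k - i)) * z ^ (n - (k - i))"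
      unfolding higher_deriv_power by (simp add: pochhammer_choose)
    show "of_nat (k choose i) * (deriv ^^ i) E 0 * (deriv ^^ (k - i)) (\<lambda>w. (w - - z) ^ n) 0
       = fact k * ((- (of_real pi * cnj z)) ^ i / fact i * of_nat (n choose (k - i)) * z ^ (n - (k - i)))"
      unfolding 1 2 3 by simp
  qed auto
  also have "\<dots> = fact k * overlap_poly n k z"
    by (simp add: overlap_poly_def sum_distrib_left)
  finally have I: "(\<integral>t. f t * (deriv ^^ k) (\<lambda>w. coherent w t) 0 \<partial>lborel) = c * (fact k * overlap_poly n k z)" .
  have "overlap1 n k z = (\<integral>t. f t * of_real (hermite1 k t) \<partial>lborel)"
    by (simp add: overlap1_def shift)
  also have "\<dots> = (\<integral>t. f t * (deriv ^^ k) (\<lambda>w. coherent w t) 0 / of_real (sqrt (fact k * pi ^ k)) \<partial>lborel)"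
    unfolding hermite1_conv_coherent by simp
  also have "\<dots> = c * (fact k * overlap_poly n k z) / of_real (sqrt (fact k * pi ^ k))"
    using I by simp
  also have "\<dots> = of_real (sqrt (pi ^ n / fact n) * fact k / sqrt (fact k * pi ^ k)) * weyl_factor z * overlap_poly n k z"
    by (simp add: c_def)
  also have "sqrt (pi ^ n / fact n) * fact k / sqrt (fact k * pi ^ k) = sqrt (fact k * pi ^ n / (fact n * pi ^ k))"
    by (simp add: real_sqrt_mult real_sqrt_divide field_simps)
  finally show ?thesis .
qed

lemma weyl_factor_rotate: "cnj (weyl_factor (u * z)) * weyl_factor (u * z) = of_real (exp (- (pi * (norm z)\<^sup>2)))"
  if "norm u = 1" for u
proof -
  have "cnj (weyl_factor (u * z)) * weyl_factor (u * z) = of_real ((norm (weyl_factor (u * z)))\<^sup>2)"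
    by (simp only: complex_norm_square mult.commute)
  also have "(norm (weyl_factor (u * z)))\<^sup>2 = exp (- (pi * (norm z)\<^sup>2))"
    using that by (simp add: norm_weyl_factor norm_mult power2_eq_square flip: exp_add)
  finally show ?thesis .
qed

text \<open>Every term has degree \<open>n - k\<close> under rotation, as \<open>cnj z\<close> counts \<open>- 1\<close>.\<close>

lemma overlap_poly_rotate:
  "overlap_poly n k (cis \<theta> * z) = cis (of_int (int n - int k) * \<theta>) * overlap_poly n k z"
  unfolding overlap_poly_def sum_distrib_left
proof (rule sum.cong)
  fix i assume "i \<in> {..k}"
  then have i: "i \<le> k" by simp
  show "(- (of_real pi * cnj (cis \<theta> * z))) ^ i / fact i * of_nat (n choose (k - i)) * (cis \<theta> * z) ^ (n - (k - i))
     = cis (of_int (int n - int k) * \<theta>) * ((- (of_real pi * cnj z)) ^ i / fact i * of_nat (n choose (k - i)) * z ^ (n - (k - i)))"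
  proof (cases "k - i \<le> n")
    case True
    have "real (n - (k - i)) - real i = of_int (int n - int k)"
      using i True by (simp add: of_nat_diff)
    then have "cis (of_int (int n - int k) * \<theta>) = cis (- (real i * \<theta>)) * cis (real (n - (k - i)) * \<theta>)"
      unfolding cis_mult by (metis add.commute diff_conv_add_uminus left_diff_distrib)
    also have "\<dots> = cnj (cis \<theta>) ^ i * cis \<theta> ^ (n - (k - i))"
      by (simp add: Complex.DeMoivre cis_cnj flip: complex_cnj_power)
    finally have c: "cis (of_int (int n - int k) * \<theta>) = cnj (cis \<theta>) ^ i * cis \<theta> ^ (n - (k - i))" .
    have "- (of_real pi * cnj (cis \<theta> * z)) = cnj (cis \<theta>) * (- (of_real pi * cnj z))"
      by simp
    then show ?thesis
      unfolding c by (simp only: power_mult_distrib) (simp add: mult_ac)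
  next
    case False
    then show ?thesis by (simp add: binomial_eq_0)
  qed
qed simp

text \<open>The squared modulus of \<open>overlap1 n k z\<close>. Its integral over \<open>\<Omega>\<close> is the eigenvalue in dimension
  one.\<close>

definition eigendensity :: "nat \<Rightarrow> nat \<Rightarrow> complex \<Rightarrow> real" where
  "eigendensity n k z = fact k * pi ^ n / (fact n * pi ^ k) * exp (- (pi * (norm z)\<^sup>2)) * (norm (overlap_poly n k z))\<^sup>2"

text \<open>The one-dimensional core. The phases of the two Weyl factors cancel and the overlap contributes
  the character of degree \<open>k - n\<close>. Together with \<open>i\<close> factors \<open>cnj (cis \<theta>)\<close> this makes the mean
  pick out the Taylor coefficient of order \<open>n - (k - i)\<close> of the \<open>k - i\<close>-th derivative of
  \<open>w \<mapsto> coherent w t\<close>, hence a multiple of its \<open>n\<close>-th derivative at \<open>0\<close>, for every \<open>i\<close>.\<close>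

lemma circle_mean_overlap1:
  "(\<integral>\<theta>. cnj (overlap1 n k (cis \<theta> * z)) * shift1 (cis \<theta> * z) (\<lambda>t. of_real (hermite1 k t)) t \<partial>circle_measure)
    = of_real (eigendensity n k z) * of_real (hermite1 n t)"
proof -
  define D where "D = (\<lambda>j. (deriv ^^ j) (\<lambda>w. coherent w t))"
  have D: "D j holomorphic_on UNIV" for j
    unfolding D_def by (intro holomorphic_higher_deriv coherent_holomorphic) auto
  have cont_D: "continuous_on UNIV (D j)" for j
    using D by (rule holomorphic_on_imp_continuous_on)
  define c where "c = sqrt (fact k * pi ^ n / (fact n * pi ^ k)) / sqrt (fact k * pi ^ k) * exp (- (pi * (norm z)\<^sup>2))"
  define a where "a = (\<lambda>i. of_nat (k choose i) * (- (of_real pi * cnj z)) ^ i)"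
  have summand: "cnj (overlap1 n k (cis \<theta> * z)) * shift1 (cis \<theta> * z) (\<lambda>t. of_real (hermite1 k t)) t
     = (\<Sum>i\<le>k. of_real c * cnj (overlap_poly n k z) * a i * (D (k - i) (cis \<theta> * z) * cis (- (of_int (int n - int (k - i)) * \<theta>))))"
    for \<theta>
  proof -
    let ?S = "\<Sum>i\<le>k. of_nat (k choose i) * (- (of_real pi * cnj (cis \<theta> * z))) ^ i * D (k - i) (cis \<theta> * z)"
    have "cnj (overlap1 n k (cis \<theta> * z)) * shift1 (cis \<theta> * z) (\<lambda>t. of_real (hermite1 k t)) t
      = of_real (sqrt (fact k * pi ^ n / (fact n * pi ^ k)) / sqrt (fact k * pi ^ k)) *
        (cnj (weyl_factor (cis \<theta> * z)) * weyl_factor (cis \<theta> * z)) * cnj (overlap_poly n k (cis \<theta> * z)) * ?S"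
      unfolding overlap1_eq shift1_hermite1 D_def by (simp add: field_simps)
    also have "\<dots> = of_real c * cnj (overlap_poly n k (cis \<theta> * z)) * ?S"
      by (simp add: weyl_factor_rotate c_def)
    also have "\<dots> = of_real c * cnj (overlap_poly n k z) * (cis (- (of_int (int n - int k) * \<theta>)) * ?S)"
      by (simp add: overlap_poly_rotate cis_cnj)
    also have "cis (- (of_int (int n - int k) * \<theta>)) * ?S
        = (\<Sum>i\<le>k. a i * (D (k - i) (cis \<theta> * z) * cis (- (of_int (int n - int (k - i)) * \<theta>))))"
      unfolding sum_distrib_left
    proof (rule sum.cong)
      fix i assume "i \<in> {..k}"
      then have "(- (of_int (int n - int (k - i)) * \<theta>)) = - (of_int (int n - int k) * \<theta>) + real i * - \<theta>"
        by (simp add: of_nat_diff algebra_simps)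
      then have e: "cis (- (of_int (int n - int (k - i)) * \<theta>)) = cis (- (of_int (int n - int k) * \<theta>)) * cnj (cis \<theta>) ^ i"
        unfolding cis_cnj Complex.DeMoivre cis_mult by (rule arg_cong)
      have "- (of_real pi * cnj (cis \<theta> * z)) = cnj (cis \<theta>) * (- (of_real pi * cnj z))"
        by simp
      then show "cis (- (of_int (int n - int k) * \<theta>)) * (of_nat (k choose i) * (- (of_real pi * cnj (cis \<theta> * z))) ^ i * D (k - i) (cis \<theta> * z))
        = a i * (D (k - i) (cis \<theta> * z) * cis (- (of_int (int n - int (k - i)) * \<theta>)))"
        unfolding a_def e by (simp only: power_mult_distrib) (simp only: mult_ac)
    qed simp
    finally show ?thesis by (simp add: sum_distrib_left mult.assoc)
  qed
  have mean: "(\<integral>\<theta>. D (k - i) (cis \<theta> * z) * cis (- (of_int (int n - int (k - i)) * \<theta>)) \<partial>circle_measure)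
     = (if k - i \<le> n then z ^ (n - (k - i)) * (deriv ^^ n) (\<lambda>w. coherent w t) 0 / fact (n - (k - i)) else 0)" for i
  proof -
    have "(deriv ^^ (n - (k - i))) (D (k - i)) = (deriv ^^ ((n - (k - i)) + (k - i))) (\<lambda>w. coherent w t)"
      unfolding D_def by (simp only: funpow_add o_apply)
    moreover have "nat (int n - int (k - i)) = n - (k - i)"
      by simp
    moreover have "0 \<le> int n - int (k - i) \<longleftrightarrow> k - i \<le> n"
      by linarith
    ultimately show ?thesis
      unfolding circle_mean_holomorphic [OF D] by (simp only: le_add_diff_inverse2 split: if_split) auto
  qed
  have "integrable circle_measure (\<lambda>\<theta>. D (k - i) (cis \<theta> * z) * cis (- (of_int (int n - int (k - i)) * \<theta>)))" for i
    by (rule integrable_circle_measure) (intro continuous_intros continuous_on_compose2 [OF cont_D], auto)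
  then have "(\<integral>\<theta>. cnj (overlap1 n k (cis \<theta> * z)) * shift1 (cis \<theta> * z) (\<lambda>t. of_real (hermite1 k t)) t \<partial>circle_measure)
     = (\<Sum>i\<le>k. of_real c * cnj (overlap_poly n k z) * a i *
         (\<integral>\<theta>. D (k - i) (cis \<theta> * z) * cis (- (of_int (int n - int (k - i)) * \<theta>)) \<partial>circle_measure))"
    unfolding summand
    by (subst Bochner_Integration.integral_sum) (simp_all only: integrable_mult_right integral_mult_right_zero)
  also have "\<dots> = (\<Sum>i\<le>k. of_real c * cnj (overlap_poly n k z) * (deriv ^^ n) (\<lambda>w. coherent w t) 0 * of_real (fact k / fact n) *
         ((- (of_real pi * cnj z)) ^ i / fact i * of_nat (n choose (k - i)) * z ^ (n - (k - i))))"
  proof (rule sum.cong)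
    fix i assume "i \<in> {..k}"
    then have i: "i \<le> k" by simp
    show "of_real c * cnj (overlap_poly n k z) * a i *
         (\<integral>\<theta>. D (k - i) (cis \<theta> * z) * cis (- (of_int (int n - int (k - i)) * \<theta>)) \<partial>circle_measure)
       = of_real c * cnj (overlap_poly n k z) * (deriv ^^ n) (\<lambda>w. coherent w t) 0 * of_real (fact k / fact n) *
         ((- (of_real pi * cnj z)) ^ i / fact i * of_nat (n choose (k - i)) * z ^ (n - (k - i)))"
    proof (cases "k - i \<le> n")
      case True
      have "of_nat (k choose i) = (fact k / (fact i * fact (k - i)) :: complex)"
        "of_nat (n choose (k - i)) = (fact n / (fact (k - i) * fact (n - (k - i))) :: complex)"
        using binomial_fact [OF i, where ?'a = complex] binomial_fact [OF True, where ?'a = complex] by simp_all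
      then show ?thesis
        unfolding mean a_def using True by (simp add: mult_ac)
    next
      case False
      then show ?thesis unfolding mean by (simp add: binomial_eq_0)
    qed
  qed simp
  also have "\<dots> = of_real (c * (fact k / fact n)) * (overlap_poly n k z * cnj (overlap_poly n k z)) * (deriv ^^ n) (\<lambda>w. coherent w t) 0"
    unfolding sum_distrib_left [symmetric] overlap_poly_def [symmetric] by (simp add: mult_ac)
  also have "\<dots> = of_real (c * (fact k / fact n) * (norm (overlap_poly n k z))\<^sup>2 * sqrt (fact n * pi ^ n)) * of_real (hermite1 n t)"
    unfolding hermite1_conv_coherent by (simp flip: complex_norm_square)
  also have "c * (fact k / fact n) * (norm (overlap_poly n k z))\<^sup>2 * sqrt (fact n * pi ^ n) = eigendensity n k z"
  proof -
    have "sqrt (fact k * pi ^ n / (fact n * pi ^ k)) / sqrt (fact k * pi ^ k) * sqrt (fact n * pi ^ n)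
        = sqrt ((fact k * pi ^ n / (fact n * pi ^ k)) / (fact k * pi ^ k) * (fact n * pi ^ n))"
      by (simp add: real_sqrt_mult real_sqrt_divide)
    also have "(fact k * pi ^ n / (fact n * pi ^ k)) / (fact k * pi ^ k) * (fact n * pi ^ n) = (pi ^ n / pi ^ k)\<^sup>2"
      by (simp add: power2_eq_square)
    also have "sqrt ((pi ^ n / pi ^ k)\<^sup>2) = pi ^ n / pi ^ k"
      by simp
    finally have "sqrt (fact k * pi ^ n / (fact n * pi ^ k)) / sqrt (fact k * pi ^ k) * sqrt (fact n * pi ^ n) = pi ^ n / pi ^ k" .
    moreover have "c * (fact k / fact n) * (norm (overlap_poly n k z))\<^sup>2 * sqrt (fact n * pi ^ n)
      = (sqrt (fact k * pi ^ n / (fact n * pi ^ k)) / sqrt (fact k * pi ^ k) * sqrt (fact n * pi ^ n)) *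
        (fact k / fact n) * exp (- (pi * (norm z)\<^sup>2)) * (norm (overlap_poly n k z))\<^sup>2"
      by (simp add: c_def)
    ultimately show ?thesis by (simp add: eigendensity_def mult_ac)
  qed
  finally show ?thesis .
qed

section \<open>Laguerre polynomials\<close>

text \<open>One formula for both cases of \<open>laguerre_diff\<close>: for \<open>n < k\<close> the first \<open>k - n\<close> terms vanish, and the
  factor \<open>(- t) ^ (k - n)\<close> of the reflection identity comes out of the others.\<close>

lemma laguerre_diff_altdef:
  "laguerre_diff k n t = (\<Sum>i\<le>k. (- t) ^ i / fact i * of_nat (n choose (k - i)))"
proof (cases "k \<le> n")
  case True
  have pow: "(- t) ^ j = (- 1) ^ j * t ^ j" for j
    by (rule power_minus)
  show ?thesis
    unfolding laguerre_diff_def laguerre_def pow using True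
    by (simp add: binomial_gbinomial mult_ac)
next
  case False
  then have nk: "n < k" by simp
  have pow: "(- 1) ^ l * t ^ l = (- t) ^ l" for l
    by (rule power_minus [symmetric])
  have "(\<Sum>i\<le>k. (- t) ^ i / fact i * of_nat (n choose (k - i)))
      = (\<Sum>i\<in>{k - n..k}. (- t) ^ i / fact i * of_nat (n choose (k - i)))"
    by (rule sum.mono_neutral_right) (auto simp: binomial_eq_0)
  also have "\<dots> = (\<Sum>l\<le>n. (- t) ^ (k - n + l) / fact (k - n + l) * of_nat (n choose (n - l)))"
    by (rule sum.reindex_bij_witness [of _ "\<lambda>l. k - n + l" "\<lambda>i. i - (k - n)"]) (use nk in auto)
  also have "\<dots> = (\<Sum>l\<le>n. fact n / fact k * (- t) ^ (k - n) * ((- t) ^ l / fact l * of_nat (k choose (n - l))))"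
  proof (rule sum.cong)
    fix l assume "l \<in> {..n}"
    then have l: "l \<le> n" by simp
    have "of_nat (n choose (n - l)) = (fact n / (fact (n - l) * fact l) :: real)"
      using binomial_fact [of "n - l" n, where ?'a = real] l by simp
    moreover have "of_nat (k choose (n - l)) = (fact k / (fact (n - l) * fact (k - n + l)) :: real)"
      using binomial_fact [of "n - l" k, where ?'a = real] l nk by simp
    ultimately show "(- t) ^ (k - n + l) / fact (k - n + l) * of_nat (n choose (n - l))
        = fact n / fact k * (- t) ^ (k - n) * ((- t) ^ l / fact l * of_nat (k choose (n - l)))"
      by (simp add: power_add mult_ac)
  qed simp
  also have "\<dots> = laguerre_diff k n t"
    unfolding laguerre_diff_def laguerre_def using False
    by (simp add: sum_distrib_left binomial_gbinomial mult_ac pow [symmetric])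
  finally show ?thesis ..
qed

text \<open>Multiplying by \<open>z ^ k\<close> avoids the negative exponent \<open>n - k\<close>, and turns each \<open>cnj z\<close> into
  \<open>(norm z)\<^sup>2\<close>.\<close>

lemma overlap_poly_laguerre:
  "overlap_poly n k z * z ^ k = z ^ n * of_real (laguerre_diff k n (pi * (norm z)\<^sup>2))"
  unfolding overlap_poly_def laguerre_diff_altdef sum_distrib_right of_real_sum sum_distrib_left
proof (rule sum.cong)
  fix i assume "i \<in> {..k}"
  then have i: "i \<le> k" by simp
  show "(- (of_real pi * cnj z)) ^ i / fact i * of_nat (n choose (k - i)) * z ^ (n - (k - i)) * z ^ k
     = z ^ n * of_real ((- (pi * (norm z)\<^sup>2)) ^ i / fact i * of_nat (n choose (k - i)))"
  proof (cases "k - i \<le> n")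
    case True
    then have "n - (k - i) + k = n + i" using i by simp
    then have z: "z ^ (n - (k - i)) * z ^ k = z ^ n * z ^ i"
      by (simp flip: power_add)
    have "complex_of_real (- (pi * (norm z)\<^sup>2)) = - (of_real pi * cnj z) * z"
      unfolding of_real_minus of_real_mult complex_norm_square by simp
    then have "complex_of_real ((- (pi * (norm z)\<^sup>2)) ^ i) = (- (of_real pi * cnj z)) ^ i * z ^ i"
      unfolding of_real_power by (simp only: power_mult_distrib)
    then show ?thesis
      using z by simp
  next
    case False
    then show ?thesis by (simp add: binomial_eq_0)
  qed
qed simp

lemma eigendensity_cmod: "eigendensity n k z = eigendensity n k (of_real (cmod z))"
proof -
  have "overlap_poly n k z = cis (of_int (int n - int k) * Arg z) * overlap_poly n k (of_real (cmod z))"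
    using overlap_poly_rotate [of n k "Arg z" "of_real (cmod z)"]
    by (cases "z = 0") (simp_all add: cis_Arg sgn_eq)
  then show ?thesis by (simp add: eigendensity_def norm_mult)
qed

lemma eigendensity_laguerre:
  assumes r: "r > 0"
  shows "eigendensity n k (of_real r) = fact k / fact n * pi powi (int n - int k) *
    (r powi (2 * int n - 2 * int k) * exp (- (pi * r\<^sup>2)) * (laguerre_diff k n (pi * r\<^sup>2))\<^sup>2)"
proof -
  have "norm (overlap_poly n k (of_real r)) * r ^ k = r ^ n * \<bar>laguerre_diff k n (pi * r\<^sup>2)\<bar>"
    using arg_cong [OF overlap_poly_laguerre [of n k "of_real r"], of norm] r
    by (simp add: norm_mult norm_power)
  then have "norm (overlap_poly n k (of_real r)) = r powi (int n - int k) * \<bar>laguerre_diff k n (pi * r\<^sup>2)\<bar>"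
    using r by (simp add: power_int_diff field_simps)
  then have "(norm (overlap_poly n k (of_real r)))\<^sup>2 = (r powi (int n - int k))\<^sup>2 * (laguerre_diff k n (pi * r\<^sup>2))\<^sup>2"
    by (simp add: power_mult_distrib)
  also have "(r powi (int n - int k))\<^sup>2 = r powi (2 * int n - 2 * int k)"
    using r by (simp add: power2_eq_square power_int_add [symmetric] algebra_simps)
  finally show ?thesis
    by (simp add: eigendensity_def power_int_diff mult_ac)
qed

section \<open>Measurability, boundedness and integrability of the overlaps\<close>

lemma weyl_factor_measurable [measurable]: "weyl_factor \<in> borel_measurable borel"
  unfolding weyl_factor_def by (intro borel_measurable_continuous_onI continuous_intros) auto

lemma overlap_poly_measurable [measurable]: "overlap_poly n k \<in> borel_measurable borel"
  unfolding overlap_poly_def by (intro borel_measurable_continuous_onI continuous_intros) auto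

lemma overlap1_measurable [measurable]: "overlap1 n k \<in> borel_measurable borel"
  unfolding overlap1_eq [abs_def] by measurable

lemma eigendensity_measurable [measurable]: "eigendensity n k \<in> borel_measurable borel"
  unfolding eigendensity_def [abs_def] by measurable

lemma norm_shift1: "norm (shift1 z g t) = norm (g (t - Re z))"
  by (simp add: shift1_def norm_mult)

lemma shift1_measurable [measurable]:
  assumes [measurable]: "g \<in> borel_measurable borel" "f \<in> borel_measurable M" "h \<in> borel_measurable M"
  shows "(\<lambda>x. shift1 (f x) g (h x)) \<in> borel_measurable M"
proof -
  have [measurable]: "Re \<in> borel_measurable borel" "Im \<in> borel_measurable borel"
    by (auto intro!: borel_measurable_continuous_onI continuous_intros)
  show ?thesis unfolding shift1_def by measurable
qed

lemma hermite1_shift1_integrable: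
  "integrable lborel (\<lambda>t. of_real (hermite1 n t) * shift1 z (\<lambda>t. of_real (hermite1 k t)) t)"
proof -
  obtain C where C: "C \<ge> 0" "\<And>t. \<bar>hermite1 k t\<bar> \<le> C"
    using hermite1_bounded [of k] by blast
  show ?thesis
  proof (rule Bochner_Integration.integrable_bound)
    show "integrable lborel (\<lambda>t. C * hermite1 n t)"
      by (rule integrable_mult_right [OF hermite1_integrable])
    show "AE t in lborel. norm (of_real (hermite1 n t) * shift1 z (\<lambda>t. of_real (hermite1 k t)) t) \<le> norm (C * hermite1 n t)"
      using C by (auto simp: norm_mult norm_shift1 mult.commute [of "\<bar>hermite1 n _\<bar>"] abs_mult intro!: mult_right_mono)
  qed measurable
qed

lemma overlap1_bounded:
  obtains B where "B \<ge> 0" "\<And>z. norm (overlap1 n k z) \<le> B"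
proof -
  obtain C where C: "C \<ge> 0" "\<And>t. \<bar>hermite1 k t\<bar> \<le> C"
    using hermite1_bounded [of k] by blast
  have "norm (overlap1 n k z) \<le> (\<integral>t. C * \<bar>hermite1 n t\<bar> \<partial>lborel)" for z
    unfolding overlap1_def
  proof (rule Bochner_Integration.integral_norm_bound_integral [OF hermite1_shift1_integrable])
    show "integrable lborel (\<lambda>t. C * \<bar>hermite1 n t\<bar>)"
      by (intro integrable_mult_right integrable_abs hermite1_integrable)
    show "norm (of_real (hermite1 n t) * shift1 z (\<lambda>t. of_real (hermite1 k t)) t) \<le> C * \<bar>hermite1 n t\<bar>" for t
      using C by (auto simp: norm_mult norm_shift1 mult.commute [of "\<bar>hermite1 n _\<bar>"] intro!: mult_right_mono)
  qed
  moreover have "0 \<le> (\<integral>t. C * \<bar>hermite1 n t\<bar> \<partial>lborel)"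
    using C by simp
  ultimately show ?thesis using that by blast
qed

lemma integrable_gaussian_moment:
  "integrable lborel (\<lambda>r. \<bar>r\<bar> ^ m * exp (- (pi * r\<^sup>2 / 2)))"
proof -
  have "integrable lborel (\<lambda>r. std_normal_density (0 + sqrt pi * r) * \<bar>0 + sqrt pi * r\<bar> ^ m)"
    by (subst lborel_integrable_real_affine_iff) (auto intro: integrable_std_normal_moment_abs)
  then have "integrable lborel (\<lambda>r. sqrt (2 * pi) / sqrt pi ^ m * (std_normal_density (0 + sqrt pi * r) * \<bar>0 + sqrt pi * r\<bar> ^ m))"
    by (rule integrable_mult_right)
  moreover have "sqrt (2 * pi) / sqrt pi ^ m * (std_normal_density (0 + sqrt pi * r) * \<bar>0 + sqrt pi * r\<bar> ^ m)
      = \<bar>r\<bar> ^ m * exp (- (pi * r\<^sup>2 / 2))" for r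
    by (simp add: std_normal_density_def abs_mult power_mult_distrib)
  ultimately show ?thesis by simp
qed

text \<open>Reduces to the moments of the normal distribution by passing to the modulus.\<close>

lemma integrable_gaussian_moment_complex:
  "integrable lborel (\<lambda>z. cmod z ^ m * exp (- (pi * (cmod z)\<^sup>2 / 2)))"
proof -
  let ?h = "\<lambda>r::real. r ^ m * exp (- (pi * r\<^sup>2 / 2))"
  have eq: "density lborel (\<lambda>r. ennreal (2 * pi * r)) = density lborel (\<lambda>r. ennreal (max 0 (2 * pi * r)))"
    by (intro density_cong) (auto simp: max_def ennreal_neg)
  have "integrable (distr lborel borel cmod) ?h"
    unfolding distr_lborel_cmod eq
  proof (subst integrable_density)
    show "integrable lborel (\<lambda>r. max 0 (2 * pi * r) *\<^sub>R ?h r)"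
    proof (rule Bochner_Integration.integrable_bound)
      show "integrable lborel (\<lambda>r. 2 * pi * (\<bar>r\<bar> ^ Suc m * exp (- (pi * r\<^sup>2 / 2))))"
        by (rule integrable_mult_right [OF integrable_gaussian_moment])
      show "AE r in lborel. norm (max 0 (2 * pi * r) *\<^sub>R ?h r) \<le> norm (2 * pi * (\<bar>r\<bar> ^ Suc m * exp (- (pi * r\<^sup>2 / 2))))"
        by (auto simp: max_def abs_mult power_abs intro!: mult_right_mono)
    qed measurable
  qed auto
  then show ?thesis
    by (simp add: integrable_distr_eq)
qed

lemma overlap1_integrable: "integrable lborel (overlap1 n k)"
proof (rule Bochner_Integration.integrable_bound)
  let ?c = "sqrt (fact k * pi ^ n / (fact n * pi ^ k))"
  let ?g = "\<lambda>z::complex. \<Sum>i\<le>k. ?c * (pi ^ i / fact i * of_nat (n choose (k - i))) *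
     (cmod z ^ (i + (n - (k - i))) * exp (- (pi * (cmod z)\<^sup>2 / 2)))"
  show "integrable lborel ?g"
    by (intro Bochner_Integration.integrable_sum integrable_mult_right integrable_gaussian_moment_complex)
  show "AE z in lborel. norm (overlap1 n k z) \<le> norm (?g z)"
  proof (rule AE_I2)
    fix z
    have "norm (overlap_poly n k z) \<le> (\<Sum>i\<le>k. (pi ^ i / fact i * of_nat (n choose (k - i))) * cmod z ^ (i + (n - (k - i))))"
      unfolding overlap_poly_def
      by (rule order_trans [OF norm_sum sum_mono])
         (simp add: norm_mult norm_divide norm_power power_mult_distrib power_add mult_ac)
    then have "norm (overlap1 n k z) \<le> ?c * exp (- (pi * (cmod z)\<^sup>2 / 2)) * (\<Sum>i\<le>k. (pi ^ i / fact i * of_nat (n choose (k - i))) * cmod z ^ (i + (n - (k - i))))"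
      unfolding overlap1_eq norm_mult norm_weyl_factor norm_of_real
      by (intro mult_mono) auto
    also have "\<dots> = ?g z"
      unfolding sum_distrib_left by (intro sum.cong) (simp_all only: mult_ac)
    also have "\<dots> \<le> norm (?g z)" by simp
    finally show "norm (overlap1 n k z) \<le> norm (?g z)" .
  qed
qed measurable

section \<open>Averaging over the torus\<close>

lemma integral_vec_prod:
  fixes f :: "'d::finite \<Rightarrow> 'a::euclidean_space \<Rightarrow> 'b::{real_normed_field,banach,second_countable_topology}"
  assumes f: "\<And>j. integrable lborel (f j)"
  shows integrable_vec_prod: "integrable lborel (\<lambda>x::'a^'d. \<Prod>j\<in>UNIV. f j (x $ j))"
    and "(\<integral>x. (\<Prod>j\<in>UNIV. f j (x $ j)) \<partial>(lborel :: ('a^'d) measure)) = (\<Prod>j\<in>UNIV. integral\<^sup>L lborel (f j))"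
proof -
  interpret product_sigma_finite "\<lambda>_::'d. lborel :: 'a measure"
    by (rule product_sigma_finite_lborel)
  have [measurable]: "f j \<in> borel_measurable borel" for j
    using borel_measurable_integrable [OF f] by simp
  show "integrable lborel (\<lambda>x::'a^'d. \<Prod>j\<in>UNIV. f j (x $ j))"
    by (subst lborel_vec, subst integrable_distr_eq) (use f product_integrable_prod [of UNIV f] in auto)
  show "(\<integral>x. (\<Prod>j\<in>UNIV. f j (x $ j)) \<partial>(lborel :: ('a^'d) measure)) = (\<Prod>j\<in>UNIV. integral\<^sup>L lborel (f j))"
    by (subst lborel_vec, subst integral_distr) (use f product_integral_prod [of UNIV f] in auto)
qed

text \<open>Each rotation of the coordinates leaves the integral unchanged, so the integral equals its mean
  over all rotations; Fubini moves the mean inside, where it splits into one mean per coordinate.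
  Boundedness of the \<open>F j\<close> makes their restrictions to every circle integrable, not only to
  almost every circle.\<close>

lemma torus_average:
  fixes F :: "'d::finite \<Rightarrow> complex \<Rightarrow> complex" and \<Omega> :: "(complex^'d) set"
  assumes \<Omega> [measurable]: "\<Omega> \<in> sets borel"
    and inv: "\<And>u z. (\<And>j. cmod (u j) = 1) \<Longrightarrow> (\<chi> j. u j * z $ j) \<in> \<Omega> \<longleftrightarrow> z \<in> \<Omega>"
    and F: "\<And>j. integrable lborel (F j)" and B: "\<And>j z. norm (F j z) \<le> B j"
  shows "(LINT z:\<Omega>|lborel. (\<Prod>j\<in>UNIV. F j (z $ j)))
    = (LINT z:\<Omega>|lborel. (\<Prod>j\<in>UNIV. \<integral>\<theta>. F j (cis \<theta> * z $ j) \<partial>circle_measure))"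
proof -
  interpret U: product_prob_space "\<lambda>_::'d. circle_measure" UNIV
    by standard
  let ?P = "PiM (UNIV :: 'd set) (\<lambda>_. circle_measure)"
  have P: "prob_space ?P"
    by (rule prob_space_PiM) (rule prob_space_circle_measure)
  interpret pair_sigma_finite ?P "lborel :: (complex^'d) measure"
    by (intro pair_sigma_finite.intro sigma_finite_lborel prob_space_imp_sigma_finite P)
  have F_meas [measurable]: "F j \<in> borel_measurable borel" for j
    using borel_measurable_integrable [OF F] by simp
  define rot :: "('d \<Rightarrow> real) \<Rightarrow> complex^'d \<Rightarrow> complex^'d" where "rot = (\<lambda>\<theta> z. \<chi> j. cis (\<theta> j) * z $ j)"
  define g where "g = (\<lambda>z::complex^'d. indicat_real \<Omega> z *\<^sub>R (\<Prod>j\<in>UNIV. F j (z $ j)))"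
  have g_meas [measurable]: "g \<in> borel_measurable borel"
    unfolding g_def by measurable
  have g: "integrable lborel g"
    unfolding g_def by (rule integrable_mult_indicator) (use integrable_vec_prod [of F] F in auto)
  have rot_distr: "distr lborel borel (rot \<theta>) = lborel" for \<theta>
    unfolding rot_def by (rule lborel_distr_torus) simp
  have rot_meas1 [measurable]: "rot \<theta> \<in> borel_measurable borel" for \<theta>
    unfolding rot_def by measurable
  have rot_meas [measurable]: "(\<lambda>x. rot (fst x) (snd x)) \<in> borel_measurable (?P \<Otimes>\<^sub>M lborel)"
    unfolding rot_def by measurable
  have int1: "integrable lborel (\<lambda>z. g (rot \<theta> z))" for \<theta>
    using g by (subst (asm) rot_distr [of \<theta>, symmetric]) (simp add: integrable_distr_eq)
  have int_norm: "(\<integral>z. norm (g (rot \<theta> z)) \<partial>lborel) = (\<integral>z. norm (g z) \<partial>lborel)" for \<theta>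
    by (subst (2) rot_distr [of \<theta>, symmetric]) (simp add: integral_distr)
  have int_g: "(\<integral>z. g (rot \<theta> z) \<partial>lborel) = (\<integral>z. g z \<partial>lborel)" for \<theta>
    by (subst (2) rot_distr [of \<theta>, symmetric]) (simp add: integral_distr)
  have int: "integrable (?P \<Otimes>\<^sub>M lborel) (\<lambda>(\<theta>, z). g (rot \<theta> z))"
  proof (rule Fubini_integrable)
    show "(\<lambda>(\<theta>, z). g (rot \<theta> z)) \<in> borel_measurable (?P \<Otimes>\<^sub>M lborel)"
      unfolding case_prod_beta by measurable
  qed (auto simp: int_norm int1)
  have "(LINT z:\<Omega>|lborel. (\<Prod>j\<in>UNIV. F j (z $ j))) = (\<integral>\<theta>. (\<integral>z. g (rot \<theta> z) \<partial>lborel) \<partial>?P)"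
    by (simp only: int_g) (simp add: prob_space.prob_space [OF P] g_def set_lebesgue_integral_def)
  also have "\<dots> = (\<integral>z. (\<integral>\<theta>. g (rot \<theta> z) \<partial>?P) \<partial>lborel)"
    by (rule Fubini_integral [OF int, symmetric])
  also have "\<dots> = (LINT z:\<Omega>|lborel. (\<Prod>j\<in>UNIV. \<integral>\<theta>. F j (cis \<theta> * z $ j) \<partial>circle_measure))"
    unfolding set_lebesgue_integral_def
  proof (rule Bochner_Integration.integral_cong [OF refl])
    fix z :: "complex^'d"
    have "indicat_real \<Omega> (rot \<theta> z) = indicat_real \<Omega> z" for \<theta>
      using inv [of "\<lambda>j. cis (\<theta> j)" z] by (simp add: rot_def indicator_def)
    then have "(\<integral>\<theta>. g (rot \<theta> z) \<partial>?P) = indicat_real \<Omega> z *\<^sub>R (\<integral>\<theta>. (\<Prod>j\<in>UNIV. F j (cis (\<theta> j) * z $ j)) \<partial>?P)"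
      by (simp add: g_def rot_def)
    also have "(\<integral>\<theta>. (\<Prod>j\<in>UNIV. F j (cis (\<theta> j) * z $ j)) \<partial>?P) = (\<Prod>j\<in>UNIV. \<integral>\<theta>. F j (cis \<theta> * z $ j) \<partial>circle_measure)"
    proof (rule U.product_integral_prod)
      show "integrable circle_measure (\<lambda>\<theta>. F j (cis \<theta> * z $ j))" for j
        by (rule circle.integrable_const_bound [of _ "B j"]) (use B in auto)
    qed simp
    finally show "(\<integral>\<theta>. g (rot \<theta> z) \<partial>?P) = indicat_real \<Omega> z *\<^sub>R (\<Prod>j\<in>UNIV. \<integral>\<theta>. F j (cis \<theta> * z $ j) \<partial>circle_measure)" .
  qed
  finally show ?thesis .
qed

section \<open>Hermite functions in several variables\<close>

lemma tf_shift_hermite: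
  "tf_shift z (hermite k) t = (\<Prod>j\<in>UNIV. shift1 (z $ j) (\<lambda>s. of_real (hermite1 (k $ j) s)) (t $ j))"
proof -
  have "2 * complex_of_real pi * \<i> * complex_of_real (t \<bullet> (\<chi> j. Im (z $ j)))
      = (\<Sum>j\<in>UNIV. 2 * complex_of_real pi * \<i> * complex_of_real (t $ j * Im (z $ j)))"
    by (simp add: inner_vec_def sum_distrib_left)
  then show ?thesis
    by (simp add: tf_shift_def shift1_def hermite_def exp_sum prod.distrib)
qed

lemma hermite_measurable [measurable]: "hermite n \<in> borel_measurable borel"
  unfolding hermite_def [abs_def] by measurable

lemma tf_shift_hermite_measurable [measurable]:
  assumes [measurable]: "f \<in> borel_measurable M" "h \<in> borel_measurable M"
  shows "(\<lambda>x. tf_shift (f x) (hermite k) (h x :: real^'d)) \<in> borel_measurable M"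
  unfolding tf_shift_hermite by measurable

lemma hermite_square_integrable: "integrable lborel (\<lambda>t. (cmod (hermite n t))\<^sup>2)"
proof -
  have "(cmod (hermite n t))\<^sup>2 = (\<Prod>j\<in>UNIV. (hermite1 (n $ j) (t $ j))\<^sup>2)" for t
    by (simp add: hermite_def prod_power_distrib flip: of_real_prod)
  then show ?thesis
    using integrable_vec_prod [of "\<lambda>j t. (hermite1 (n $ j) t)\<^sup>2"] by (simp add: hermite1_square_integrable)
qed

lemma hermite_L2: "hermite n \<in> L2"
  using hermite_square_integrable [of n]
  by (simp add: L2_def integrable_completion measurable_completion)

lemma stft_hermite:
  "stft (hermite k) (hermite n) z = (\<Prod>j\<in>UNIV. cnj (overlap1 (n $ j) (k $ j) (z $ j)))"
proof -
  let ?f = "\<lambda>j t. of_real (hermite1 (n $ j) t) * cnj (shift1 (z $ j) (\<lambda>s. of_real (hermite1 (k $ j) s)) t)"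
  have f: "integrable lborel (?f j)" for j
    using integrable_cnj [OF hermite1_shift1_integrable [of "n $ j" "z $ j" "k $ j"]] by simp
  have "stft (hermite k) (hermite n) z = (\<integral>t. hermite n t * cnj (tf_shift z (hermite k) t) \<partial>lborel)"
    unfolding stft_def L2_inner_def by (rule integral_completion) measurable
  also have "\<dots> = (\<integral>t. (\<Prod>j\<in>UNIV. ?f j (t $ j)) \<partial>lborel)"
    unfolding tf_shift_hermite by (simp add: hermite_def prod.distrib)
  also have "\<dots> = (\<Prod>j\<in>UNIV. integral\<^sup>L lborel (?f j))"
    by (rule integral_vec_prod(2)) (rule f)
  also have "\<dots> = (\<Prod>j\<in>UNIV. cnj (overlap1 (n $ j) (k $ j) (z $ j)))"
  proof (rule prod.cong)
    fix j
    show "integral\<^sup>L lborel (?f j) = cnj (overlap1 (n $ j) (k $ j) (z $ j))"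
      unfolding overlap1_def by (subst Bochner_Integration.integral_cnj [symmetric]) simp
  qed simp
  finally show ?thesis .
qed

lemma norm_tf_shift: "norm (tf_shift z g t) = norm (g (t - (\<chi> j. Re (z $ j))))"
proof -
  have "2 * complex_of_real pi * \<i> * complex_of_real (t \<bullet> (\<chi> j. Im (z $ j))) = \<i> * of_real (2 * pi * (t \<bullet> (\<chi> j. Im (z $ j))))"
    by simp
  then show ?thesis
    unfolding tf_shift_def norm_mult by (simp only: norm_exp_i_times)
qed

text \<open>After averaging over the torus each coordinate contributes \<open>circle_mean_overlap1\<close>; the product
  of the factors \<open>hermite1 (n $ j) (t $ j)\<close> no longer depends on \<open>z\<close> and leaves the integral.\<close>

lemma localization_op_hermite_pointwise:
  fixes \<Omega> :: "(complex^'d) set"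
  assumes \<Omega>: "\<Omega> \<in> sets borel"
    and inv: "\<And>u z. (\<And>j. cmod (u j) = 1) \<Longrightarrow> (\<chi> j. u j * z $ j) \<in> \<Omega> \<longleftrightarrow> z \<in> \<Omega>"
  shows "(LINT z:\<Omega>|lborel. stft (hermite k) (hermite n) z * tf_shift z (hermite k) t)
    = of_real (LINT z:\<Omega>|lborel. (\<Prod>j\<in>UNIV. eigendensity (n $ j) (k $ j) (z $ j))) * hermite n t"
proof -
  define F where "F = (\<lambda>j z. cnj (overlap1 (n $ j) (k $ j) z) * shift1 z (\<lambda>s. of_real (hermite1 (k $ j) s)) (t $ j))"
  have "\<exists>B. \<forall>z. norm (F j z) \<le> B" for j
  proof -
    obtain B where B: "B \<ge> 0" "\<And>z. norm (overlap1 (n $ j) (k $ j) z) \<le> B"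
      using overlap1_bounded by blast
    obtain C where C: "C \<ge> 0" "\<And>t. \<bar>hermite1 (k $ j) t\<bar> \<le> C"
      using hermite1_bounded by blast
    have "norm (F j z) \<le> B * C" for z
      unfolding F_def norm_mult using B C by (intro mult_mono) (auto simp: norm_shift1)
    then show ?thesis by blast
  qed
  then obtain B where B: "\<And>j z. norm (F j z) \<le> B j" by metis
  have F: "integrable lborel (F j)" for j
  proof -
    obtain C where C: "C \<ge> 0" "\<And>t. \<bar>hermite1 (k $ j) t\<bar> \<le> C"
      using hermite1_bounded by blast
    show ?thesis
    proof (rule Bochner_Integration.integrable_bound)
      show "integrable lborel (\<lambda>z. of_real C * overlap1 (n $ j) (k $ j) z)"
        by (rule integrable_mult_right [OF overlap1_integrable])
      show "AE z in lborel. norm (F j z) \<le> norm (of_real C * overlap1 (n $ j) (k $ j) z)"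
        using C by (auto simp: F_def norm_mult norm_shift1 mult.commute [of C] intro!: mult_left_mono)
    qed (unfold F_def, measurable)
  qed
  have "(LINT z:\<Omega>|lborel. stft (hermite k) (hermite n) z * tf_shift z (hermite k) t)
      = (LINT z:\<Omega>|lborel. (\<Prod>j\<in>UNIV. F j (z $ j)))"
    by (simp add: stft_hermite tf_shift_hermite F_def prod.distrib)
  also have "\<dots> = (LINT z:\<Omega>|lborel. (\<Prod>j\<in>UNIV. \<integral>\<theta>. F j (cis \<theta> * z $ j) \<partial>circle_measure))"
    by (rule torus_average [OF \<Omega> inv F B])
  also have "\<dots> = (LINT z:\<Omega>|lborel. of_real (\<Prod>j\<in>UNIV. eigendensity (n $ j) (k $ j) (z $ j)) * hermite n t)"
    unfolding F_def circle_mean_overlap1 by (simp add: hermite_def prod.distrib)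
  also have "\<dots> = of_real (LINT z:\<Omega>|lborel. (\<Prod>j\<in>UNIV. eigendensity (n $ j) (k $ j) (z $ j))) * hermite n t"
    unfolding set_lebesgue_integral_def
    by (simp only: scaleR_conv_of_real of_real_mult [symmetric] mult.assoc [symmetric] integral_mult_left_zero)
       (simp add: integral_of_real del: of_real_mult of_real_prod)
  finally show ?thesis .
qed

section \<open>The eigenvalue as an integral over the shadow\<close>

lemma reinhardt_shadow_torus_invariant:
  assumes "reinhardt_shadow \<Omega> W" and u: "\<And>j. cmod (u j) = 1"
  shows "(\<chi> j. u j * z $ j) \<in> \<Omega> \<longleftrightarrow> z \<in> \<Omega>"
proof -
  have "modulus_map (\<chi> j. u j * z $ j) = modulus_map z"
    using u by (simp add: modulus_map_def norm_mult vec_eq_iff)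
  then show ?thesis
    using assms(1) by (simp add: reinhardt_shadow_def)
qed

lemma reinhardt_shadow_borel:
  assumes "reinhardt_shadow \<Omega> W"
  shows "W \<in> sets borel" "\<Omega> \<in> sets borel"
proof -
  have "nonneg_orthant = (\<Inter>j. {r :: real^'a. 0 \<le> r $ j})"
    by (auto simp: nonneg_orthant_def)
  also have "closed \<dots>"
    by (intro closed_INT ballI closed_Collect_le continuous_intros)
  finally have "closed (nonneg_orthant :: (real^'a) set)" .
  moreover obtain T where "open T" "W = nonneg_orthant \<inter> T"
    using assms by (auto simp: reinhardt_shadow_def openin_open)
  ultimately show W: "W \<in> sets borel" by auto
  have "modulus_map -` W \<inter> space borel \<in> sets borel"
    by (rule measurable_sets [OF modulus_map_measurable W])
  then show "\<Omega> \<in> sets borel"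
    using assms by (simp add: reinhardt_shadow_def)
qed

text \<open>Polar coordinates for functions of the moduli.\<close>

lemma integral_reinhardt:
  fixes e :: "'d::finite \<Rightarrow> real \<Rightarrow> real"
  assumes sh: "reinhardt_shadow \<Omega> W" and e [measurable]: "\<And>j. e j \<in> borel_measurable borel"
  shows "(LINT z:\<Omega>|lborel. (\<Prod>j\<in>UNIV. e j (cmod (z $ j))))
    = (LINT r:W|lborel. (\<Prod>j\<in>UNIV. 2 * pi * r $ j * e j (r $ j)))"
proof -
  note [measurable] = reinhardt_shadow_borel [OF sh]
  let ?D = "\<lambda>r::real^'d. \<Prod>j\<in>UNIV. max 0 (2 * pi * r $ j)"
  have D: "(\<lambda>r::real^'d. \<Prod>j\<in>UNIV. ennreal (2 * pi * r $ j)) = (\<lambda>r. ennreal (?D r))"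
  proof
    fix r :: "real^'d"
    have "(\<Prod>j\<in>UNIV. ennreal (2 * pi * r $ j)) = (\<Prod>j\<in>UNIV. ennreal (max 0 (2 * pi * r $ j)))"
      by (intro prod.cong) (auto simp: max_def ennreal_neg)
    also have "\<dots> = ennreal (?D r)"
      by (rule prod_ennreal) auto
    finally show "(\<Prod>j\<in>UNIV. ennreal (2 * pi * r $ j)) = ennreal (?D r)" .
  qed
  have "(LINT z:\<Omega>|lborel. (\<Prod>j\<in>UNIV. e j (cmod (z $ j))))
      = (\<integral>z. indicat_real W (modulus_map z) *\<^sub>R (\<Prod>j\<in>UNIV. e j (modulus_map z $ j)) \<partial>lborel)"
    unfolding set_lebesgue_integral_def
    by (rule Bochner_Integration.integral_cong) (use sh in \<open>auto simp: reinhardt_shadow_def modulus_map_def indicator_def\<close>)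
  also have "\<dots> = (\<integral>r. indicat_real W r *\<^sub>R (\<Prod>j\<in>UNIV. e j (r $ j)) \<partial>distr lborel borel modulus_map)"
    by (rule integral_distr [symmetric]) measurable
  also have "\<dots> = (\<integral>r. ?D r *\<^sub>R (indicat_real W r *\<^sub>R (\<Prod>j\<in>UNIV. e j (r $ j))) \<partial>lborel)"
    unfolding distr_lborel_modulus_map D
    by (rule integral_density) (measurable, auto intro!: prod_nonneg)
  also have "\<dots> = (LINT r:W|lborel. (\<Prod>j\<in>UNIV. 2 * pi * r $ j * e j (r $ j)))"
    unfolding set_lebesgue_integral_def
  proof (rule Bochner_Integration.integral_cong [OF refl])
    fix r
    have "?D r = (\<Prod>j\<in>UNIV. 2 * pi * r $ j)" if "r \<in> W"
    proof -
      have "r \<in> nonneg_orthant"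
        using that sh by (auto simp: reinhardt_shadow_def dest: openin_imp_subset)
      then show ?thesis
        by (intro prod.cong) (auto simp: nonneg_orthant_def max_def)
    qed
    then show "?D r *\<^sub>R (indicat_real W r *\<^sub>R (\<Prod>j\<in>UNIV. e j (r $ j)))
        = indicat_real W r *\<^sub>R (\<Prod>j\<in>UNIV. 2 * pi * r $ j * e j (r $ j))"
      by (cases "r \<in> W") (auto simp: prod.distrib)
  qed
  finally show ?thesis .
qed

lemma power_int_sum:
  assumes "x \<noteq> (0 :: 'a::field)"
  shows "x powi (\<Sum>j\<in>A. f j) = (\<Prod>j\<in>A. x powi f j)"
  by (induction A rule: infinite_finite_induct) (use assms in \<open>simp_all add: power_int_add\<close>)

lemma power_int_measurable [measurable]:
  "f \<in> borel_measurable M \<Longrightarrow> (\<lambda>x. f x powi m :: real) \<in> borel_measurable M"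
  by (cases "m \<ge> 0") (simp_all add: power_int_def)

lemma laguerre_diff_measurable [measurable]: "laguerre_diff k n \<in> borel_measurable borel"
  unfolding laguerre_diff_altdef [abs_def] by measurable

text \<open>On the coordinate hyperplanes \<open>r $ j powi m\<close> with negative \<open>m\<close> takes its default value \<open>0\<close>, so the
  Laguerre formula for the density only holds off these null sets.\<close>

lemma AE_vec_nth_nonzero: "AE r in lborel. \<forall>j. (r :: real^'d) $ j \<noteq> 0"
proof -
  have "AE r in lborel. (r :: real^'d) $ j \<noteq> 0" for j
  proof -
    have "negligible {r :: real^'d. r $ j = 0}"
      by (rule negligible_standard_hyperplane_cart)
    moreover have "{r :: real^'d. r $ j = 0} \<in> sets lborel"
      by measurable
    ultimately have "{r :: real^'d. r $ j = 0} \<in> null_sets lborel"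
      by (metis null_sets_completion_iff negligible_iff_null_sets)
    then show ?thesis
      using AE_not_in [of "{r :: real^'d. r $ j = 0}" lborel] by simp
  qed
  then show ?thesis
    by (subst AE_all_countable) auto
qed

lemma eigenvalue_formula:
  fixes W :: "(real^'d) set" and n k :: "nat^'d"
  assumes sh: "reinhardt_shadow \<Omega> W"
  shows "(LINT z:\<Omega>|lborel. (\<Prod>j\<in>UNIV. eigendensity (n $ j) (k $ j) (z $ j)))
    = (2 * pi) ^ CARD('d) * (multi_fact k / multi_fact n) *
        pi powi (\<Sum>j\<in>UNIV. int (n $ j) - int (k $ j)) *
        (LINT r:W|lebesgue.
          (\<Prod>j\<in>UNIV. (r $ j) powi (2 * int (n $ j) - 2 * int (k $ j) + 1)) *
          exp (- pi * (norm r)\<^sup>2) *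
          (\<Prod>j\<in>UNIV. laguerre_diff (k $ j) (n $ j) (pi * (r $ j)\<^sup>2))\<^sup>2)"
    (is "_ = ?c * (LINT r:W|lebesgue. ?f r)")
proof -
  note [measurable] = reinhardt_shadow_borel [OF sh]
  have f_meas [measurable]: "?f \<in> borel_measurable borel"
    by measurable
  have "(LINT z:\<Omega>|lborel. (\<Prod>j\<in>UNIV. eigendensity (n $ j) (k $ j) (z $ j)))
      = (LINT z:\<Omega>|lborel. (\<Prod>j\<in>UNIV. eigendensity (n $ j) (k $ j) (of_real (cmod (z $ j)))))"
    by (simp flip: eigendensity_cmod)
  also have "\<dots> = (LINT r:W|lborel. (\<Prod>j\<in>UNIV. 2 * pi * r $ j * eigendensity (n $ j) (k $ j) (of_real (r $ j))))"
    by (rule integral_reinhardt [OF sh, of "\<lambda>j r. eigendensity (n $ j) (k $ j) (of_real r)"]) measurable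
  also have "\<dots> = (LINT r:W|lborel. ?c * ?f r)"
    unfolding set_lebesgue_integral_def
  proof (rule integral_cong_AE)
    show "AE r in lborel. indicat_real W r *\<^sub>R (\<Prod>j\<in>UNIV. 2 * pi * r $ j * eigendensity (n $ j) (k $ j) (of_real (r $ j)))
        = indicat_real W r *\<^sub>R (?c * ?f r)"
      using AE_vec_nth_nonzero
    proof eventually_elim
      fix r :: "real^'d" assume nz: "\<forall>j. r $ j \<noteq> 0"
      show "indicat_real W r *\<^sub>R (\<Prod>j\<in>UNIV. 2 * pi * r $ j * eigendensity (n $ j) (k $ j) (of_real (r $ j)))
        = indicat_real W r *\<^sub>R (?c * ?f r)"
      proof (cases "r \<in> W")
        case True
        then have "r \<in> nonneg_orthant"
          using sh by (auto simp: reinhardt_shadow_def dest: openin_imp_subset)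
        then have pos: "r $ j > 0" for j
          using nz by (auto simp: nonneg_orthant_def less_le)
        have "(\<Prod>j\<in>UNIV. 2 * pi * r $ j * eigendensity (n $ j) (k $ j) (of_real (r $ j)))
          = (\<Prod>j\<in>UNIV. (2 * pi) * (fact (k $ j) / fact (n $ j)) * pi powi (int (n $ j) - int (k $ j)) *
              ((r $ j) powi (2 * int (n $ j) - 2 * int (k $ j) + 1) * exp (- (pi * (r $ j)\<^sup>2)) * (laguerre_diff (k $ j) (n $ j) (pi * (r $ j)\<^sup>2))\<^sup>2))"
        proof (rule prod.cong [OF refl])
          fix j
          have "(r $ j) powi (2 * int (n $ j) - 2 * int (k $ j) + 1) = (r $ j) powi (2 * int (n $ j) - 2 * int (k $ j)) * r $ j"
            using pos [of j] by (simp add: power_int_add)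
          then show "2 * pi * r $ j * eigendensity (n $ j) (k $ j) (of_real (r $ j))
            = (2 * pi) * (fact (k $ j) / fact (n $ j)) * pi powi (int (n $ j) - int (k $ j)) *
              ((r $ j) powi (2 * int (n $ j) - 2 * int (k $ j) + 1) * exp (- (pi * (r $ j)\<^sup>2)) * (laguerre_diff (k $ j) (n $ j) (pi * (r $ j)\<^sup>2))\<^sup>2)"
            unfolding eigendensity_laguerre [OF pos] by (simp add: mult_ac)
        qed
        also have "\<dots> = ?c * ?f r"
        proof -
          have "(\<Prod>j\<in>UNIV. pi powi (int (n $ j) - int (k $ j))) = pi powi (\<Sum>j\<in>UNIV. int (n $ j) - int (k $ j))"
            by (simp add: power_int_sum)
          moreover have "(\<Prod>j\<in>UNIV. exp (- (pi * (r $ j)\<^sup>2))) = exp (- pi * (norm r)\<^sup>2)"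
            by (simp add: norm_vec_def L2_set_def sum_nonneg sum_distrib_left sum_negf flip: exp_sum)
          ultimately show ?thesis
            by (simp add: prod.distrib prod_dividef multi_fact_def prod_power_distrib)
        qed
        finally show ?thesis by simp
      qed simp
    qed
  qed measurable
  also have "\<dots> = ?c * (LINT r:W|lborel. ?f r)"
    by (rule set_integral_mult_right)
  also have "(LINT r:W|lborel. ?f r) = (LINT r:W|lebesgue. ?f r)"
    unfolding set_lebesgue_integral_def by (rule integral_completion [symmetric]) measurable
  finally show ?thesis .
qed

section \<open>The localization operator\<close>

text \<open>Fubini's theorem is applied on the product of two Borel-Lebesgue measures and so needs a kernel
  that is jointly Borel measurable, whereas members of \<open>L2\<close> are only Lebesgue measurable.\<close>

lemma L2_borel_representative:
  fixes u :: "real^'d \<Rightarrow> complex"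
  assumes u: "u \<in> L2"
  obtains u' where "u' \<in> borel_measurable borel" "integrable lborel (\<lambda>t. (cmod (u' t))\<^sup>2)"
    "\<And>h. h \<in> borel_measurable borel \<Longrightarrow> L2_inner h u = (\<integral>t. h t * cnj (u' t) \<partial>lborel)"
proof -
  have u_meas: "u \<in> borel_measurable (completion lborel)" and u_int: "integrable lebesgue (\<lambda>t. (cmod (u t))\<^sup>2)"
    using u by (auto simp: L2_def)
  have "(\<lambda>t. Re (u t)) \<in> borel_measurable (completion lborel)"
    using u_meas by measurable
  then obtain v where v: "v \<in> borel_measurable lborel" "AE t in lborel. Re (u t) = v t"
    using completion_ex_borel_measurable_real by blast
  have "(\<lambda>t. Im (u t)) \<in> borel_measurable (completion lborel)"
    using u_meas by measurable
  then obtain w where w: "w \<in> borel_measurable lborel" "AE t in lborel. Im (u t) = w t"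
    using completion_ex_borel_measurable_real by blast
  define u' where "u' = (\<lambda>t. of_real (v t) + \<i> * of_real (w t) :: complex)"
  have u': "u' \<in> borel_measurable lborel"
    unfolding u'_def using v(1) w(1) by measurable
  have ae: "AE t in lborel. u t = u' t"
    using v(2) w(2) by eventually_elim (simp add: u'_def complex_eq_iff)
  have [measurable]: "u' \<in> borel_measurable borel" using u' by simp
  have ae': "AE t in lebesgue. u t = u' t"
    using ae by (rule AE_completion)
  have u'_leb: "u' \<in> borel_measurable lebesgue"
    using u' by (rule measurable_completion)
  have "integrable lebesgue (\<lambda>t. (cmod (u' t))\<^sup>2)"
    using u_int by (rule integrable_cong_AE_imp) (use u'_leb ae' in auto)
  then have "integrable lborel (\<lambda>t. (cmod (u' t))\<^sup>2)"
    by (subst (asm) integrable_completion) auto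
  moreover have "L2_inner h u = (\<integral>t. h t * cnj (u' t) \<partial>lborel)"
    if h [measurable]: "h \<in> borel_measurable borel" for h
  proof -
    have h_leb: "h \<in> borel_measurable lebesgue"
      using h by (simp add: measurable_completion)
    have cnj_leb: "(\<lambda>t. cnj (v t)) \<in> borel_measurable lebesgue" if "v \<in> borel_measurable lebesgue" for v :: "real^'d \<Rightarrow> complex"
      using that by measurable
    have "L2_inner h u = (\<integral>t. h t * cnj (u' t) \<partial>lebesgue)"
      unfolding L2_inner_def
      by (rule integral_cong_AE) (use h_leb u_meas u'_leb cnj_leb ae' in auto)
    also have "\<dots> = (\<integral>t. h t * cnj (u' t) \<partial>lborel)"
      by (rule integral_completion) measurable
    finally show ?thesis .
  qed
  ultimately show ?thesis
    using that [of u'] by auto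
qed

lemma integrable_translate:
  fixes f :: "'a::euclidean_space \<Rightarrow> 'b::{banach,second_countable_topology}"
  assumes f: "integrable lborel f"
  shows "integrable lborel (\<lambda>t. f (t - x))" "(\<integral>t. f (t - x) \<partial>lborel) = integral\<^sup>L lborel f"
proof -
  have [measurable]: "f \<in> borel_measurable borel"
    using borel_measurable_integrable [OF f] by simp
  have d: "distr lborel borel (\<lambda>t. t - x) = (lborel :: 'a measure)"
    using lborel_distr_plus [of "- x"] by (simp add: add.commute [of "- x"] diff_conv_add_uminus [symmetric] cong: distr_cong)
  show "integrable lborel (\<lambda>t. f (t - x))"
    using f by (subst (asm) d [symmetric]) (simp add: integrable_distr_eq)
  show "(\<integral>t. f (t - x) \<partial>lborel) = integral\<^sup>L lborel f"
    by (subst (2) d [symmetric]) (simp add: integral_distr)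
qed

text \<open>The transform is integrable over phase space, and for fixed \<open>z\<close> the integral over \<open>t\<close> is bounded
  independently of \<open>z\<close>, by translation invariance and \<open>a * b \<le> a\<^sup>2 + b\<^sup>2\<close>.\<close>

lemma localization_kernel_integrable:
  fixes \<Omega> :: "(complex^'d) set" and u :: "real^'d \<Rightarrow> complex"
  assumes \<Omega> [measurable]: "\<Omega> \<in> sets borel"
    and u_meas [measurable]: "u \<in> borel_measurable borel"
    and u: "integrable lborel (\<lambda>t. (cmod (u t))\<^sup>2)"
  shows "integrable (lborel \<Otimes>\<^sub>M lborel)
    (\<lambda>(z, t). indicat_real \<Omega> z *\<^sub>R (stft (hermite k) (hermite n) z * tf_shift z (hermite k) t * cnj (u t)))"
proof -
  define V where "V = stft (hermite k) (hermite n)"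
  define G where "G = (\<integral>t. (cmod (hermite k t))\<^sup>2 + (cmod (u t))\<^sup>2 \<partial>(lborel :: (real^'d) measure))"
  have V_eq: "V = (\<lambda>z. \<Prod>j\<in>UNIV. cnj (overlap1 (n $ j) (k $ j) (z $ j)))"
    by (simp add: V_def stft_hermite fun_eq_iff)
  have V_meas [measurable]: "V \<in> borel_measurable borel"
    unfolding V_eq by measurable
  have V: "integrable lborel V"
    unfolding V_eq by (rule integrable_vec_prod) (rule integrable_cnj [OF overlap1_integrable])
  have maj: "integrable lborel (\<lambda>t. (cmod (hermite k (t - x)))\<^sup>2 + (cmod (u t))\<^sup>2)"
    and maj_int: "(\<integral>t. (cmod (hermite k (t - x)))\<^sup>2 + (cmod (u t))\<^sup>2 \<partial>lborel) = G" for x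
    using integrable_translate [OF hermite_square_integrable [of k], of x] u hermite_square_integrable [of k]
    by (auto simp: G_def)
  have bd: "norm (tf_shift z (hermite k) t * cnj (u t)) \<le> (cmod (hermite k (t - (\<chi> j. Re (z $ j)))))\<^sup>2 + (cmod (u t))\<^sup>2" for z t
  proof -
    have "a * b \<le> a\<^sup>2 + b\<^sup>2" for a b :: real
    proof -
      have "0 \<le> (a - b)\<^sup>2 + a\<^sup>2 + b\<^sup>2" by simp
      then show ?thesis by (simp add: power2_diff)
    qed
    then show ?thesis by (simp add: norm_mult norm_tf_shift)
  qed
  have inner_int: "integrable lborel (\<lambda>t. tf_shift z (hermite k) t * cnj (u t))" for z
    by (rule Bochner_Integration.integrable_bound [OF maj [of "\<chi> j. Re (z $ j)"]]) (use bd [of z] in auto)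
  have inner_le: "(\<integral>t. norm (tf_shift z (hermite k) t * cnj (u t)) \<partial>lborel) \<le> G" for z
    unfolding maj_int [of "\<chi> j. Re (z $ j)", symmetric]
    by (rule integral_mono [OF integrable_norm [OF inner_int] maj]) (rule bd)
  have G: "G \<ge> 0" unfolding G_def by simp
  let ?K = "\<lambda>(z, t). indicat_real \<Omega> z *\<^sub>R (V z * tf_shift z (hermite k) t * cnj (u t))"
  have "integrable (lborel \<Otimes>\<^sub>M lborel) ?K"
  proof (rule lborel_pair.Fubini_integrable)
    show K_meas: "?K \<in> borel_measurable (lborel \<Otimes>\<^sub>M lborel)"
      unfolding case_prod_beta by measurable
    have nK: "(\<integral>t. norm (?K (z, t)) \<partial>lborel) = indicat_real \<Omega> z * norm (V z) * (\<integral>t. norm (tf_shift z (hermite k) t * cnj (u t)) \<partial>lborel)" for z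
      by (simp add: norm_mult mult.assoc)
    show "integrable lborel (\<lambda>z. \<integral>t. norm (?K (z, t)) \<partial>lborel)"
    proof (rule Bochner_Integration.integrable_bound [OF integrable_mult_right [OF V, of "of_real G"]])
      show "(\<lambda>z. \<integral>t. norm (?K (z, t)) \<partial>lborel) \<in> borel_measurable lborel"
        using K_meas by measurable
      have "norm (\<integral>t. norm (?K (z, t)) \<partial>lborel) \<le> norm (of_real G * V z)" for z
      proof -
        have "norm (\<integral>t. norm (?K (z, t)) \<partial>lborel) = indicat_real \<Omega> z * norm (V z) * (\<integral>t. norm (tf_shift z (hermite k) t * cnj (u t)) \<partial>lborel)"
          unfolding nK by (simp add: abs_mult)
        also have "\<dots> \<le> 1 * norm (V z) * G"
          by (intro mult_mono inner_le) (auto simp: indicator_def)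
        finally show ?thesis using G by (simp add: norm_mult mult.commute)
      qed
      then show "AE z in lborel. norm (\<integral>t. norm (?K (z, t)) \<partial>lborel) \<le> norm (of_real G * V z)"
        by simp
    qed
    have "integrable lborel (\<lambda>t. ?K (z, t))" for z
      using integrable_scaleR_right [OF integrable_mult_right [OF inner_int [of z], of "V z"], of "indicat_real \<Omega> z"]
      by (simp add: mult.assoc)
    then show "AE z in lborel. integrable lborel (\<lambda>t. ?K (z, t))"
      by simp
  qed
  then show ?thesis by (simp add: V_def)
qed

theorem corollary4p6:
  fixes \<Omega> :: "(complex^'d) set" and W :: "(real^'d) set" and k :: "nat^'d"
  assumes "reinhardt_domain \<Omega>"
    and "reinhardt_shadow \<Omega> W"
    and "thin_at_infinity \<Omega>"
  shows "\<forall>n :: nat^'d. localization_op \<Omega> (hermite k) (hermite n)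
    (\<lambda>t. complex_of_real
      ((2 * pi) ^ CARD('d) * (multi_fact k / multi_fact n) *
        pi powi (\<Sum>j\<in>UNIV. int (n $ j) - int (k $ j)) *
        (LINT r:W|lebesgue.
          (\<Prod>j\<in>UNIV. (r $ j) powi (2 * int (n $ j) - 2 * int (k $ j) + 1)) *
          exp (- pi * (norm r)\<^sup>2) *
          (\<Prod>j\<in>UNIV. laguerre_diff (k $ j) (n $ j) (pi * (r $ j)\<^sup>2))\<^sup>2)) *
      hermite n t)"
proof
  fix n :: "nat^'d"
  note sh = \<open>reinhardt_shadow \<Omega> W\<close>
  note \<Omega> [measurable] = reinhardt_shadow_borel(2) [OF sh]
  define c where "c = (LINT z:\<Omega>|lborel. (\<Prod>j\<in>UNIV. eigendensity (n $ j) (k $ j) (z $ j)))"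
  define F where "F = (\<lambda>z t. stft (hermite k) (hermite n) z * tf_shift z (hermite k) t)"
  have F_meas [measurable]: "F z \<in> borel_measurable borel" for z
    unfolding F_def by measurable
  have weak: "set_integrable lebesgue \<Omega> (\<lambda>z. L2_inner (F z) u) \<and>
      L2_inner (\<lambda>t. of_real c * hermite n t) u = (LINT z:\<Omega>|lebesgue. L2_inner (F z) u)"
    if "u \<in> L2" for u
  proof -
    obtain u' where u'_meas [measurable]: "u' \<in> borel_measurable borel"
      and u': "integrable lborel (\<lambda>t. (cmod (u' t))\<^sup>2)"
      and inner: "\<And>h. h \<in> borel_measurable borel \<Longrightarrow> L2_inner h u = (\<integral>t. h t * cnj (u' t) \<partial>lborel)"
      using L2_borel_representative [OF \<open>u \<in> L2\<close>] by blast
    let ?K = "\<lambda>z t. indicat_real \<Omega> z *\<^sub>R (F z t * cnj (u' t))"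
    have K: "integrable (lborel \<Otimes>\<^sub>M lborel) (\<lambda>(z, t). ?K z t)"
      using localization_kernel_integrable [OF \<Omega> u'_meas u', of k n] by (simp add: F_def)
    \<comment> \<open>Integrating first over \<open>t\<close> gives the weak integrand, integrating first over \<open>z\<close> the
      pointwise eigenvalue equation.\<close>
    have fst: "integrable lborel (\<lambda>z. \<integral>t. ?K z t \<partial>lborel)"
      using lborel_pair.integrable_fst [OF K] by simp
    have in_eq: "indicat_real \<Omega> z *\<^sub>R L2_inner (F z) u = (\<integral>t. ?K z t \<partial>lborel)" for z
      by (simp add: inner)
    have "set_integrable lebesgue \<Omega> (\<lambda>z. L2_inner (F z) u)"
      unfolding set_integrable_def in_eq
      using fst by (subst integrable_completion) auto
    moreover have "(LINT z:\<Omega>|lebesgue. L2_inner (F z) u) = (\<integral>z. (\<integral>t. ?K z t \<partial>lborel) \<partial>lborel)"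
      unfolding set_lebesgue_integral_def in_eq
      by (rule integral_completion) (use fst in auto)
    moreover have "(\<integral>z. (\<integral>t. ?K z t \<partial>lborel) \<partial>lborel) = (\<integral>t. (\<integral>z. ?K z t \<partial>lborel) \<partial>lborel)"
      by (rule lborel_pair.Fubini_integral [OF K, symmetric])
    moreover have "(\<integral>z. ?K z t \<partial>lborel) = (of_real c * hermite n t) * cnj (u' t)" for t
    proof -
      have "(\<integral>z. ?K z t \<partial>lborel) = (\<integral>z. (indicat_real \<Omega> z *\<^sub>R F z t) * cnj (u' t) \<partial>lborel)"
        by simp
      also have "\<dots> = (LINT z:\<Omega>|lborel. F z t) * cnj (u' t)"
        unfolding set_lebesgue_integral_def by (rule integral_mult_left_zero)
      also have "(LINT z:\<Omega>|lborel. F z t) = of_real c * hermite n t"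
        unfolding F_def c_def
        by (rule localization_op_hermite_pointwise [OF \<Omega> reinhardt_shadow_torus_invariant [OF sh]])
      finally show ?thesis .
    qed
    ultimately show ?thesis by (simp add: inner)
  qed
  have "(\<lambda>t. of_real c * hermite n t) \<in> L2"
    using hermite_L2 [of n] by (auto simp: L2_def norm_mult power_mult_distrib)
  then have "localization_op \<Omega> (hermite k) (hermite n) (\<lambda>t. of_real c * hermite n t)"
    using weak by (simp add: localization_op_def has_weak_L2_integral_def hermite_L2 F_def)
  then show "localization_op \<Omega> (hermite k) (hermite n)
    (\<lambda>t. complex_of_real
      ((2 * pi) ^ CARD('d) * (multi_fact k / multi_fact n) *
        pi powi (\<Sum>j\<in>UNIV. int (n $ j) - int (k $ j)) *
        (LINT r:W|lebesgue.
          (\<Prod>j\<in>UNIV. (r $ j) powi (2 * int (n $ j) - 2 * int (k $ j) + 1)) *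
          exp (- pi * (norm r)\<^sup>2) *
          (\<Prod>j\<in>UNIV. laguerre_diff (k $ j) (n $ j) (pi * (r $ j)\<^sup>2))\<^sup>2)) *
      hermite n t)"
    unfolding c_def eigenvalue_formula [OF sh] .
qed

end
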